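(* Let $(J,K,\tau_0,V,W,\tau_1,R,S)$ be data as described in the context, and let $\mathcal{B}$ be the associated generalized $q$-boson algebra. Assume that the linear map $\tau_1^l : V \to W^*$, $\tau_1^l(v)(w)=\tau_1(v,w)$, is injective, and that $R$ is the Nichols algebra of $V$. Then $R$ is simple as a left $\mathcal{B}$-module.
   Context: Let $k$ be a field of arbitrary characteristic; everything is over $k$, and gradings are by $\mathbb{N}=\{0,1,2,\dots\}$ unless otherwise stated. For a Hopf algebra $J$ with bijective antipode $\mathcal{S}$, write $\Delta(a)=a_1\otimes a_2$. ${}_J^J\mathcal{YD}$ is the braided tensor category of Yetter–Drinfeld modules over $J$: left $J$-modules $V$ (action $a\rightharpoonup v$) with a left $J$-comodule structure $v\mapsto v_J\otimes v_V$ such that $a\rightharpoonup v\mapsto a_1v_J\mathcal{S}(a_3)\otimes(a_2\rightharpoonup v_V)$; the braiding is $c(v\otimes w)=(v_J\rightharpoonup w)\otimes v_V$. The tensor algebra $T(V)$ is a braided graded Hopf algebra in ${}_J^J\mathcal{YD}$ in which elements of $V$ are primitive. A pre-Nichols algebra of $V$ is a quotient $R=T(V)/I=\bigoplus_{n\ge 0}R(n)$ by a homogeneous bi-ideal $I$ in ${}_J^J\mathcal{YD}$ with $I\cap V=0$ (equivalently, a braided graded bialgebra with $R(0)=k$, $R(1)=V$, generated by $R(1)$). It is the Nichols algebra of $V$ if $I$ is largest possible, equivalently if $R(1)$ equals the space $P(R)$ of all primitives. The coproduct of $R$ is written $\Delta_R(r)=r_{(1)}\otimes r_{(2)}$. The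 bosonization $R\rtimes J$ (Radford biproduct) is the Hopf algebra on $R\otimes J$ (write $ra=r\otimes a$) with $(ra)(sb)=r(a_1\rightharpoonup s)(a_2b)$ and $\Delta(ra)=r_{(1)}(r_{(2)J}a_1)\otimes r_{(2)R}a_2$. A skew pairing of Hopf algebras $A,X$ (with bijective antipodes) is a linear form $\tau:A\otimes X\to k$ with $\tau(ab,x)=\tau(a,x_1)\tau(b,x_2)$, $\tau(a,xy)=\tau(a_1,y)\tau(a_2,x)$, $\tau(1,x)=\varepsilon(x)$, $\tau(a,1)=\varepsilon(a)$. Data: $J,K$ are Hopf algebras with bijective antipodes; $\tau_0:J\otimes K\to k$ is a skew pairing; $V\in{}_J^J\mathcal{YD}$, $W\in{}_K^K\mathcal{YD}$; $\tau_1:V\otimes W\to k$ is a linear form with $\tau_1(a\rightharpoonup v,w)=\tau_0(a,w_K)\tau_1(v,w_W)$ and $\tau_1(v,x\rightharpoonup w)=\tau_0(v_J,\mathcal{S}(x))\tau_1(v_V,w)$ for all $a\in J,x\in K,v\in V,w\in W$; $R,S$ are pre-Nichols algebras of $V,W$ respectively. Then $\tau_0,\tau_1$ extend uniquely to a skew pairing $\tau:(R\rtimes J)\otimes(S\rtimes K)\to k$ with $\tau(a,w)=0=\tau(v,x)$ for $a\in J$, $x\in K$, $v\in V$, $w\in W$. The generalized $q$-boson algebra $\mathcal{B}$ is the unique algebra structure on the vector space $R\otimes S$ with unit $1\otimes 1$ that includes $R=R\otimes k$ and $S=k\otimes S$ as subalgebras and satisfies $rs=r\otimes s$ ($r\in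 R,s\in S$) and $wv=\tau_0(v_J,w_K)\,v_V\otimes w_W+\tau_1(v,w)\,1\otimes 1$ ($v\in V,w\in W$). $R$ is a left $\mathcal{B}$-module on which $R\subset\mathcal{B}$ acts by left multiplication and $s\in S$ acts by $s\triangleright r=\tau(r_{(1)},s)r_{(2)}$. *)

theory Defs
  imports Main "HOL.Vector_Spaces" "HOL-Library.Function_Algebras" "HOL-Library.FuncSet"
begin

section \<open>Vector spaces and tensor products\<close>

text \<open>
  A vector space is a subspace \<open>carrier\<close> of an ambient type that carries a vector space
  structure.  All axioms below are relativised to carriers, and values of functions outside
  the carriers are irrelevant.
\<close>

record ('k, 'a) vec =
  carrier :: "'a set"
  scale :: "'k \<Rightarrow> 'a \<Rightarrow> 'a"

definition is_subspace :: "('k::field, 'a::ab_group_add, 'z) vec_scheme \<Rightarrow> 'a set \<Rightarrow> bool" where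
  "is_subspace A U \<longleftrightarrow> U \<subseteq> carrier A \<and> 0 \<in> U \<and> (\<forall>x\<in>U. \<forall>y\<in>U. x + y \<in> U)
     \<and> (\<forall>c. \<forall>x\<in>U. scale A c x \<in> U)"

definition vec_space :: "('k::field, 'a::ab_group_add, 'z) vec_scheme \<Rightarrow> bool" where
  "vec_space A \<longleftrightarrow> vector_space (scale A) \<and> is_subspace A (carrier A)"

definition ground :: "('k::field, 'k) vec" where
  "ground = \<lparr>carrier = UNIV, scale = (*)\<rparr>"

definition lin ::
  "('k::field, 'a::ab_group_add, 'y) vec_scheme \<Rightarrow> ('k, 'b::ab_group_add, 'z) vec_scheme
     \<Rightarrow> ('a \<Rightarrow> 'b) \<Rightarrow> bool" where
  "lin A B f \<longleftrightarrow> (\<forall>x\<in>carrier A. f x \<in> carrier B)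
     \<and> (\<forall>x\<in>carrier A. \<forall>y\<in>carrier A. f (x + y) = f x + f y)
     \<and> (\<forall>c. \<forall>x\<in>carrier A. f (scale A c x) = scale B c (f x))"

definition bilin ::
  "('k::field, 'a::ab_group_add, 'x) vec_scheme \<Rightarrow> ('k, 'b::ab_group_add, 'y) vec_scheme
     \<Rightarrow> ('k, 'c::ab_group_add, 'z) vec_scheme \<Rightarrow> ('a \<Rightarrow> 'b \<Rightarrow> 'c) \<Rightarrow> bool" where
  "bilin A B C f \<longleftrightarrow> (\<forall>a\<in>carrier A. lin B C (f a)) \<and> (\<forall>b\<in>carrier B. lin A C (\<lambda>a. f a b))"

text \<open>
  The tensor product of \<open>A\<close> and \<open>B\<close> is modelled inside the dual of the space of bilinear forms
  on \<open>A \<times> B\<close>: the pure tensor of \<open>a\<close> and \<open>b\<close> is evaluation at \<open>(a, b)\<close>, and the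
  tensor product is spanned by the pure tensors.  Over a field this has the universal property of
  the tensor product, see \<open>sweedler_sum_tens\<close>, \<open>lin_sweedler\<close> and \<open>sweedler_unique\<close> below.
\<close>

type_synonym ('k, 'a, 'b) tens = "('a \<Rightarrow> 'b \<Rightarrow> 'k) \<Rightarrow> 'k"

definition tens ::
  "('k::field, 'a::ab_group_add, 'y) vec_scheme \<Rightarrow> ('k, 'b::ab_group_add, 'z) vec_scheme
     \<Rightarrow> 'a \<Rightarrow> 'b \<Rightarrow> ('k, 'a, 'b) tens" where
  "tens A B a b = (\<lambda>\<beta>. if bilin A B ground \<beta> then \<beta> a b else 0)"

definition tens_sum ::
  "('k::field, 'a::ab_group_add, 'y) vec_scheme \<Rightarrow> ('k, 'b::ab_group_add, 'z) vec_scheme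
     \<Rightarrow> ('a \<times> 'b) list \<Rightarrow> ('k, 'a, 'b) tens" where
  "tens_sum A B xs = (\<Sum>(a, b)\<leftarrow>xs. tens A B a b)"

text \<open>
  For subspaces \<open>X\<close> of \<open>A\<close> and \<open>Y\<close> of \<open>B\<close>, the image of the tensor product of \<open>X\<close> and \<open>Y\<close> in
  the one of \<open>A\<close> and \<open>B\<close>.
\<close>

definition tens_sub ::
  "('k::field, 'a::ab_group_add, 'y) vec_scheme \<Rightarrow> ('k, 'b::ab_group_add, 'z) vec_scheme
     \<Rightarrow> 'a set \<Rightarrow> 'b set \<Rightarrow> ('k, 'a, 'b) tens set" where
  "tens_sub A B X Y = {tens_sum A B xs | xs. set xs \<subseteq> X \<times> Y}"

definition tensor ::
  "('k::field, 'a::ab_group_add, 'y) vec_scheme \<Rightarrow> ('k, 'b::ab_group_add, 'z) vec_scheme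
     \<Rightarrow> ('k, ('k, 'a, 'b) tens) vec" where
  "tensor A B = \<lparr>carrier = tens_sub A B (carrier A) (carrier B), scale = (\<lambda>c t \<beta>. c * t \<beta>)\<rparr>"

definition tens3 ::
  "('k::field, 'a::ab_group_add, 'x) vec_scheme \<Rightarrow> ('k, 'b::ab_group_add, 'y) vec_scheme
     \<Rightarrow> ('k, 'c::ab_group_add, 'z) vec_scheme
     \<Rightarrow> 'a \<Rightarrow> 'b \<Rightarrow> 'c \<Rightarrow> ('k, 'a, ('k, 'b, 'c) tens) tens" where
  "tens3 A B C a b c = tens A (tensor B C) a (tens B C b c)"

text \<open>
  The Sweedler-style sum of \<open>f a b\<close> over a presentation of \<open>t\<close> as a sum of pure tensors of \<open>a\<close>
  and \<open>b\<close>, i.e. the image of \<open>t\<close> under the linear map induced by the bilinear map \<open>f\<close>.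
\<close>

definition sweedler ::
  "('k::field, 'a::ab_group_add, 'y) vec_scheme \<Rightarrow> ('k, 'b::ab_group_add, 'z) vec_scheme
     \<Rightarrow> ('k, 'a, 'b) tens \<Rightarrow> ('a \<Rightarrow> 'b \<Rightarrow> 'c::ab_group_add) \<Rightarrow> 'c" where
  "sweedler A B t f =
     (\<Sum>(a, b)\<leftarrow>(SOME xs. set xs \<subseteq> carrier A \<times> carrier B \<and> tens_sum A B xs = t). f a b)"


subsection \<open>The universal property\<close>

lemma sum_list_fun_apply: "(\<Sum>x\<leftarrow>xs. F x) z = (\<Sum>x\<leftarrow>xs. F x z)"
  by (induction xs) auto

lemma separating_functional:
  assumes "vector_space (s :: 'k::field \<Rightarrow> 'c::ab_group_add \<Rightarrow> 'c)" "c \<noteq> 0"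
  shows "\<exists>\<phi>. (\<forall>x y. \<phi> (x + y) = \<phi> x + \<phi> y) \<and> (\<forall>r x. \<phi> (s r x) = r * \<phi> x) \<and> \<phi> c \<noteq> (0::'k)"
proof -
  interpret vector_space_pair s "(*) :: 'k \<Rightarrow> 'k \<Rightarrow> 'k"
    using assms(1) unfolding vector_space_pair_def
    by (auto intro!: vector_space.intro simp: algebra_simps)
  have "\<not> vs1.dependent {c}" using assms(2) by simp
  from linear_independent_extend[OF this, of "\<lambda>_. 1"]
  obtain g where g: "Vector_Spaces.linear s (*) g" "g c = 1" by auto
  interpret g: Vector_Spaces.linear s "(*)" g by (rule g(1))
  show ?thesis using g.add g.scale g(2) by (intro exI[of _ g]) auto
qed

lemma tens_sum_eq_imp:
  assumes "bilin A B C f" "vec_space C"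
    and xs: "set xs \<subseteq> carrier A \<times> carrier B" and ys: "set ys \<subseteq> carrier A \<times> carrier B"
    and eq: "tens_sum A B xs = tens_sum A B ys"
  shows "(\<Sum>(a, b)\<leftarrow>xs. f a b) = (\<Sum>(a, b)\<leftarrow>ys. f a b)"
proof (rule ccontr)
  let ?X = "\<Sum>(a, b)\<leftarrow>xs. f a b" and ?Y = "\<Sum>(a, b)\<leftarrow>ys. f a b"
  assume "?X \<noteq> ?Y"
  then obtain \<phi> where \<phi>: "\<And>x y. \<phi> (x + y) = \<phi> x + \<phi> y" "\<And>r x. \<phi> (scale C r x) = r * \<phi> x"
    and n: "\<phi> (?X - ?Y) \<noteq> 0"
    using separating_functional[of "scale C" "?X - ?Y"] assms(2) by (auto simp: vec_space_def)
  have b: "bilin A B ground (\<lambda>a b. \<phi> (f a b))"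
    using assms(1) \<phi> by (simp add: bilin_def lin_def ground_def)
  have \<phi>0: "\<phi> 0 = 0" using \<phi>(1)[of 0 0] by (metis add_0 add_left_imp_eq add.right_neutral)
  have s: "\<phi> (\<Sum>(a, b)\<leftarrow>zs. f a b) = tens_sum A B zs (\<lambda>a b. \<phi> (f a b))" for zs
    using b by (induction zs) (auto simp: tens_sum_def tens_def \<phi> \<phi>0)
  have "\<phi> ?X = \<phi> ?Y" using s[of xs] s[of ys] eq by simp
  moreover have "\<phi> ?X = \<phi> (?X - ?Y) + \<phi> ?Y" using \<phi>(1)[of "?X - ?Y" ?Y] by simp
  ultimately show False using n by simp
qed

lemma sweedler_sum_tens:
  assumes "bilin A B C f" "vec_space C" "set xs \<subseteq> carrier A \<times> carrier B"
  shows "sweedler A B (tens_sum A B xs) f = (\<Sum>(a, b)\<leftarrow>xs. f a b)"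
proof -
  let ?P = "\<lambda>ys. set ys \<subseteq> carrier A \<times> carrier B \<and> tens_sum A B ys = tens_sum A B xs"
  have "?P (SOME ys. ?P ys)" by (rule someI[of ?P xs]) (use assms in auto)
  then show ?thesis unfolding sweedler_def using tens_sum_eq_imp[OF assms(1,2) _ assms(3)] by blast
qed

lemma sweedler_tens:
  assumes "bilin A B C f" "vec_space C" "a \<in> carrier A" "b \<in> carrier B"
  shows "sweedler A B (tens A B a b) f = f a b"
  using sweedler_sum_tens[OF assms(1,2), of "[(a, b)]"] assms(3,4) by (simp add: tens_sum_def)

lemma tens_sum_append: "tens_sum A B (xs @ ys) = tens_sum A B xs + tens_sum A B ys"
  by (simp add: tens_sum_def)

lemma tens_scale:
  assumes "vec_space A" "a \<in> carrier A" "b \<in> carrier B"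
  shows "tens A B (scale A c a) b = (\<lambda>\<beta>. c * tens A B a b \<beta>)"
  using assms by (auto simp: tens_def bilin_def lin_def ground_def)

lemma tens_sum_scale:
  assumes "vec_space A" "set xs \<subseteq> carrier A \<times> carrier B"
  shows "tens_sum A B (map (\<lambda>(a, b). (scale A c a, b)) xs) = (\<lambda>\<beta>. c * tens_sum A B xs \<beta>)"
  using assms(2)
proof (induction xs)
  case (Cons p xs)
  obtain a b where p: "p = (a, b)" by (cases p)
  show ?case
    using Cons tens_scale[OF assms(1), of a b B c]
    by (auto simp: p tens_sum_def distrib_left plus_fun_def fun_eq_iff)
qed (simp add: tens_sum_def zero_fun_def)

lemma vec_space_tensor:
  assumes "vec_space A" "vec_space B"
  shows "vec_space (tensor A B)"
proof -
  have "vector_space (scale (tensor A B))"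
    by (unfold_locales) (auto simp: tensor_def plus_fun_def algebra_simps)
  moreover have "is_subspace (tensor A B) (carrier (tensor A B))"
    unfolding is_subspace_def
  proof (intro conjI ballI allI)
    show "0 \<in> carrier (tensor A B)"
      by (auto simp: tensor_def tens_sub_def tens_sum_def intro: exI[of _ "[]"])
  next
    fix x y assume "x \<in> carrier (tensor A B)" "y \<in> carrier (tensor A B)"
    then obtain xs ys where "x = tens_sum A B xs" "y = tens_sum A B ys"
      "set xs \<subseteq> carrier A \<times> carrier B" "set ys \<subseteq> carrier A \<times> carrier B"
      by (auto simp: tensor_def tens_sub_def)
    then show "x + y \<in> carrier (tensor A B)"
      by (auto simp: tensor_def tens_sub_def tens_sum_append[symmetric] intro!: exI[of _ "xs @ ys"])
  next
    fix c x assume "x \<in> carrier (tensor A B)"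
    then obtain xs where xs: "x = tens_sum A B xs" "set xs \<subseteq> carrier A \<times> carrier B"
      by (auto simp: tensor_def tens_sub_def)
    have "set (map (\<lambda>(a, b). (scale A c a, b)) xs) \<subseteq> carrier A \<times> carrier B"
      using xs(2) assms(1) by (auto simp: vec_space_def is_subspace_def)
    moreover have "scale (tensor A B) c x = tens_sum A B (map (\<lambda>(a, b). (scale A c a, b)) xs)"
      using tens_sum_scale[OF assms(1) xs(2), of c] xs(1) by (simp add: tensor_def)
    ultimately show "scale (tensor A B) c x \<in> carrier (tensor A B)"
      unfolding tensor_def tens_sub_def vec.select_convs by blast
  qed simp
  ultimately show ?thesis by (simp add: vec_space_def)
qed

lemma bilin_tens:
  assumes "vec_space A" "vec_space B"
  shows "bilin A B (tensor A B) (tens A B)"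
proof -
  have "tens A B a b \<in> carrier (tensor A B)" if "a \<in> carrier A" "b \<in> carrier B" for a b
    using that by (auto simp: tensor_def tens_sub_def tens_sum_def intro!: exI[of _ "[(a, b)]"])
  then show ?thesis
    by (auto simp: bilin_def lin_def tens_def tensor_def ground_def plus_fun_def fun_eq_iff)
qed

lemma lin_sweedler:
  assumes f: "bilin A B C f" "vec_space C" and A: "vec_space A" "vec_space B"
  shows "lin (tensor A B) C (\<lambda>t. sweedler A B t f)"
proof -
  have sub: "is_subspace C (carrier C)" using f(2) by (simp add: vec_space_def)
  interpret C: vector_space "scale C" using f(2) by (simp add: vec_space_def)
  have mem: "(\<Sum>(a, b)\<leftarrow>xs. f a b) \<in> carrier C" if "set xs \<subseteq> carrier A \<times> carrier B" for xs
    using that f(1) sub by (induction xs) (auto simp: is_subspace_def bilin_def lin_def)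
  have sc: "(\<Sum>(a, b)\<leftarrow>map (\<lambda>(a, b). (scale A c a, b)) xs. f a b) = scale C c (\<Sum>(a, b)\<leftarrow>xs. f a b)"
    if "set xs \<subseteq> carrier A \<times> carrier B" for xs c
    using that f(1) by (induction xs) (auto simp: C.scale_right_distrib bilin_def lin_def)
  show ?thesis unfolding lin_def
  proof (intro conjI ballI allI)
    fix x assume "x \<in> carrier (tensor A B)"
    then obtain xs where xs: "x = tens_sum A B xs" "set xs \<subseteq> carrier A \<times> carrier B"
      by (auto simp: tensor_def tens_sub_def)
    show "sweedler A B x f \<in> carrier C" using sweedler_sum_tens[OF f xs(2)] mem[OF xs(2)] xs(1) by simp
    fix c
    have xs': "set (map (\<lambda>(a, b). (scale A c a, b)) xs) \<subseteq> carrier A \<times> carrier B"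
      using xs(2) A(1) by (auto simp: vec_space_def is_subspace_def)
    show "sweedler A B (scale (tensor A B) c x) f = scale C c (sweedler A B x f)"
      using sweedler_sum_tens[OF f xs(2)] sweedler_sum_tens[OF f xs'] sc[OF xs(2), of c]
        tens_sum_scale[OF A(1) xs(2), of c] xs(1) by (simp add: tensor_def)
    fix y assume "y \<in> carrier (tensor A B)"
    then obtain ys where ys: "y = tens_sum A B ys" "set ys \<subseteq> carrier A \<times> carrier B"
      by (auto simp: tensor_def tens_sub_def)
    have "set (xs @ ys) \<subseteq> carrier A \<times> carrier B" using xs ys by simp
    from sweedler_sum_tens[OF f this]
    show "sweedler A B (x + y) f = sweedler A B x f + sweedler A B y f"
      using sweedler_sum_tens[OF f xs(2)] sweedler_sum_tens[OF f ys(2)] xs(1) ys(1)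
      by (simp add: tens_sum_append)
  qed
qed

lemma sweedler_unique:
  assumes f: "bilin A B C f" "vec_space C" and A: "vec_space A" "vec_space B"
    and g: "lin (tensor A B) C g"
    and gf: "\<And>a b. a \<in> carrier A \<Longrightarrow> b \<in> carrier B \<Longrightarrow> g (tens A B a b) = f a b"
    and t: "t \<in> carrier (tensor A B)"
  shows "g t = sweedler A B t f"
proof -
  obtain xs where xs: "t = tens_sum A B xs" "set xs \<subseteq> carrier A \<times> carrier B"
    using t by (auto simp: tensor_def tens_sub_def)
  have T0: "0 \<in> carrier (tensor A B)"
    using vec_space_tensor[OF A] by (simp add: vec_space_def is_subspace_def)
  then have "g (0 + 0) = g 0 + g 0" using g unfolding lin_def by blast
  then have g0: "g 0 = 0" by (metis add_0 add_left_imp_eq add.right_neutral)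
  have "g (tens_sum A B xs) = (\<Sum>(a, b)\<leftarrow>xs. f a b)" using xs(2)
  proof (induction xs)
    case Nil then show ?case using g0 unfolding tens_sum_def by (simp only: list.map sum_list.Nil)
  next
    case (Cons p xs)
    obtain a b where p: "p = (a, b)" by (cases p)
    have "tens A B a b \<in> carrier (tensor A B)"
      using bilin_tens[OF A] Cons.prems by (auto simp: p bilin_def lin_def)
    moreover have "tens_sum A B xs \<in> carrier (tensor A B)"
      using Cons.prems by (auto simp: tensor_def tens_sub_def)
    ultimately have "g (tens A B a b + tens_sum A B xs) = g (tens A B a b) + g (tens_sum A B xs)"
      using g unfolding lin_def by blast
    moreover have "tens_sum A B (p # xs) = tens A B a b + tens_sum A B xs"
      by (simp add: p tens_sum_def)
    moreover have "g (tens A B a b) = f a b" "g (tens_sum A B xs) = (\<Sum>(a, b)\<leftarrow>xs. f a b)"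
      using Cons gf by (auto simp: p)
    ultimately show ?case by (simp only: p list.map sum_list.Cons prod.case)
  qed
  then show ?thesis using sweedler_sum_tens[OF f xs(2)] xs(1) by simp
qed


section \<open>Algebras, coalgebras, Hopf algebras, modules\<close>

definition is_algebra ::
  "('k::field, 'a::ab_group_add, 'z) vec_scheme \<Rightarrow> ('a \<Rightarrow> 'a \<Rightarrow> 'a) \<Rightarrow> 'a \<Rightarrow> bool" where
  "is_algebra A m e \<longleftrightarrow> vec_space A \<and> bilin A A A m \<and> e \<in> carrier A
     \<and> (\<forall>x\<in>carrier A. \<forall>y\<in>carrier A. \<forall>z\<in>carrier A. m (m x y) z = m x (m y z))
     \<and> (\<forall>x\<in>carrier A. m e x = x \<and> m x e = x)"

definition is_coalgebra ::
  "('k::field, 'a::ab_group_add, 'z) vec_scheme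
     \<Rightarrow> ('a \<Rightarrow> ('k, 'a, 'a) tens) \<Rightarrow> ('a \<Rightarrow> 'k) \<Rightarrow> bool" where
  "is_coalgebra A \<Delta> \<epsilon> \<longleftrightarrow> vec_space A \<and> lin A (tensor A A) \<Delta> \<and> lin A ground \<epsilon>
     \<and> (\<forall>x\<in>carrier A.
          sweedler A A (\<Delta> x) (\<lambda>x\<^sub>1 x\<^sub>2. sweedler A A (\<Delta> x\<^sub>1) (\<lambda>x\<^sub>1\<^sub>1 x\<^sub>1\<^sub>2. tens3 A A A x\<^sub>1\<^sub>1 x\<^sub>1\<^sub>2 x\<^sub>2))
        = sweedler A A (\<Delta> x) (\<lambda>x\<^sub>1 x\<^sub>2. sweedler A A (\<Delta> x\<^sub>2) (\<lambda>x\<^sub>2\<^sub>1 x\<^sub>2\<^sub>2. tens3 A A A x\<^sub>1 x\<^sub>2\<^sub>1 x\<^sub>2\<^sub>2)))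
     \<and> (\<forall>x\<in>carrier A. sweedler A A (\<Delta> x) (\<lambda>x\<^sub>1 x\<^sub>2. scale A (\<epsilon> x\<^sub>1) x\<^sub>2) = x
          \<and> sweedler A A (\<Delta> x) (\<lambda>x\<^sub>1 x\<^sub>2. scale A (\<epsilon> x\<^sub>2) x\<^sub>1) = x)"

record ('k, 'a) bialgebra = "('k, 'a) vec" +
  hmul :: "'a \<Rightarrow> 'a \<Rightarrow> 'a"
  hone :: 'a
  hcomul :: "'a \<Rightarrow> ('k, 'a, 'a) tens"
  hcounit :: "'a \<Rightarrow> 'k"

record ('k, 'a) hopf = "('k, 'a) bialgebra" +
  antipode :: "'a \<Rightarrow> 'a"

definition is_bialgebra :: "('k::field, 'a::ab_group_add, 'z) bialgebra_scheme \<Rightarrow> bool" where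
  "is_bialgebra H \<longleftrightarrow> is_algebra H (hmul H) (hone H) \<and> is_coalgebra H (hcomul H) (hcounit H)
     \<and> (\<forall>x\<in>carrier H. \<forall>y\<in>carrier H. hcomul H (hmul H x y) =
          sweedler H H (hcomul H x) (\<lambda>x\<^sub>1 x\<^sub>2. sweedler H H (hcomul H y) (\<lambda>y\<^sub>1 y\<^sub>2.
            tens H H (hmul H x\<^sub>1 y\<^sub>1) (hmul H x\<^sub>2 y\<^sub>2))))
     \<and> hcomul H (hone H) = tens H H (hone H) (hone H)
     \<and> (\<forall>x\<in>carrier H. \<forall>y\<in>carrier H. hcounit H (hmul H x y) = hcounit H x * hcounit H y)
     \<and> hcounit H (hone H) = 1"

definition hopf_algebra :: "('k::field, 'a::ab_group_add, 'z) hopf_scheme \<Rightarrow> bool" where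
  "hopf_algebra H \<longleftrightarrow> is_bialgebra H \<and> lin H H (antipode H)
     \<and> (\<forall>x\<in>carrier H.
          sweedler H H (hcomul H x) (\<lambda>x\<^sub>1 x\<^sub>2. hmul H (antipode H x\<^sub>1) x\<^sub>2) = scale H (hcounit H x) (hone H)
        \<and> sweedler H H (hcomul H x) (\<lambda>x\<^sub>1 x\<^sub>2. hmul H x\<^sub>1 (antipode H x\<^sub>2)) = scale H (hcounit H x) (hone H))"

definition bij_antipode :: "('k::field, 'a::ab_group_add, 'z) hopf_scheme \<Rightarrow> bool" where
  "bij_antipode H \<longleftrightarrow> bij_betw (antipode H) (carrier H) (carrier H)"

definition left_module ::
  "('k::field, 'a::ab_group_add, 'y) vec_scheme \<Rightarrow> ('a \<Rightarrow> 'a \<Rightarrow> 'a) \<Rightarrow> 'a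
     \<Rightarrow> ('k, 'v::ab_group_add, 'z) vec_scheme \<Rightarrow> ('a \<Rightarrow> 'v \<Rightarrow> 'v) \<Rightarrow> bool" where
  "left_module A m e M ac \<longleftrightarrow> vec_space M \<and> bilin A M M ac
     \<and> (\<forall>a\<in>carrier A. \<forall>b\<in>carrier A. \<forall>v\<in>carrier M. ac (m a b) v = ac a (ac b v))
     \<and> (\<forall>v\<in>carrier M. ac e v = v)"

definition simple_left_module ::
  "('k::field, 'a::ab_group_add, 'y) vec_scheme \<Rightarrow> ('a \<Rightarrow> 'a \<Rightarrow> 'a) \<Rightarrow> 'a
     \<Rightarrow> ('k, 'v::ab_group_add, 'z) vec_scheme \<Rightarrow> ('a \<Rightarrow> 'v \<Rightarrow> 'v) \<Rightarrow> bool" where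
  "simple_left_module A m e M ac \<longleftrightarrow> left_module A m e M ac \<and> carrier M \<noteq> {0}
     \<and> (\<forall>N. is_subspace M N \<and> (\<forall>a\<in>carrier A. \<forall>v\<in>N. ac a v \<in> N) \<longrightarrow> N = {0} \<or> N = carrier M)"


section \<open>Yetter-Drinfeld modules\<close>

record ('k, 'v, 'j) yd = "('k, 'v) vec" +
  act :: "'j \<Rightarrow> 'v \<Rightarrow> 'v"
  coact :: "'v \<Rightarrow> ('k, 'j, 'v) tens"

definition yd_module ::
  "('k::field, 'j::ab_group_add, 'y) hopf_scheme \<Rightarrow> ('k, 'v::ab_group_add, 'j, 'z) yd_scheme \<Rightarrow> bool" where
  "yd_module J V \<longleftrightarrow> left_module J (hmul J) (hone J) V (act V)
     \<and> lin V (tensor J V) (coact V)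
     \<and> (\<forall>v\<in>carrier V.
          sweedler J V (coact V v) (\<lambda>j v'. sweedler J J (hcomul J j) (\<lambda>j\<^sub>1 j\<^sub>2. tens3 J J V j\<^sub>1 j\<^sub>2 v'))
        = sweedler J V (coact V v) (\<lambda>j v'. sweedler J V (coact V v') (\<lambda>j' v''. tens3 J J V j j' v'')))
     \<and> (\<forall>v\<in>carrier V. sweedler J V (coact V v) (\<lambda>j v'. scale V (hcounit J j) v') = v)
     \<and> (\<forall>a\<in>carrier J. \<forall>v\<in>carrier V. coact V (act V a v) =
          sweedler J J (hcomul J a) (\<lambda>a\<^sub>1 a'. sweedler J J (hcomul J a') (\<lambda>a\<^sub>2 a\<^sub>3.
            sweedler J V (coact V v) (\<lambda>j v'.
              tens J V (hmul J (hmul J a\<^sub>1 j) (antipode J a\<^sub>3)) (act V a\<^sub>2 v')))))"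

definition yd_hom ::
  "('k::field, 'j::ab_group_add, 'x) hopf_scheme \<Rightarrow> ('k, 'v::ab_group_add, 'j, 'y) yd_scheme
     \<Rightarrow> ('k, 'w::ab_group_add, 'j, 'z) yd_scheme \<Rightarrow> ('v \<Rightarrow> 'w) \<Rightarrow> bool" where
  "yd_hom J V W f \<longleftrightarrow> lin V W f
     \<and> (\<forall>a\<in>carrier J. \<forall>v\<in>carrier V. f (act V a v) = act W a (f v))
     \<and> (\<forall>v\<in>carrier V. coact W (f v) = sweedler J V (coact V v) (\<lambda>j v'. tens J W j (f v')))"

definition yd_unit :: "('k::field, 'j::ab_group_add, 'z) hopf_scheme \<Rightarrow> ('k, 'k, 'j) yd" where
  "yd_unit J = \<lparr>carrier = UNIV, scale = (*), act = (\<lambda>a c. hcounit J a * c),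
     coact = (\<lambda>c. tens J ground (hone J) c)\<rparr>"

definition yd_tensor ::
  "('k::field, 'j::ab_group_add, 'x) hopf_scheme \<Rightarrow> ('k, 'v::ab_group_add, 'j, 'y) yd_scheme
     \<Rightarrow> ('k, 'w::ab_group_add, 'j, 'z) yd_scheme \<Rightarrow> ('k, ('k, 'v, 'w) tens, 'j) yd" where
  "yd_tensor J V W = \<lparr>carrier = carrier (tensor V W), scale = scale (tensor V W),
     act = (\<lambda>a t. sweedler J J (hcomul J a) (\<lambda>a\<^sub>1 a\<^sub>2. sweedler V W t (\<lambda>v w.
       tens V W (act V a\<^sub>1 v) (act W a\<^sub>2 w)))),
     coact = (\<lambda>t. sweedler V W t (\<lambda>v w.
       sweedler J V (coact V v) (\<lambda>i v'. sweedler J W (coact W w) (\<lambda>j w'.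
         tens J (tensor V W) (hmul J i j) (tens V W v' w')))))\<rparr>"

definition braiding ::
  "('k::field, 'j::ab_group_add, 'x) hopf_scheme \<Rightarrow> ('k, 'v::ab_group_add, 'j, 'y) yd_scheme
     \<Rightarrow> ('k, 'w::ab_group_add, 'j, 'z) yd_scheme \<Rightarrow> ('k, 'v, 'w) tens \<Rightarrow> ('k, 'w, 'v) tens" where
  "braiding J V W t = sweedler V W t (\<lambda>v w.
     sweedler J V (coact V v) (\<lambda>j v'. tens W V (act W j w) v'))"


section \<open>Pre-Nichols and Nichols algebras\<close>

record ('k, 'r, 'j) graded_yd = "('k, 'r, 'j) yd" +
  mul :: "'r \<Rightarrow> 'r \<Rightarrow> 'r"
  unit :: 'r
  comul :: "'r \<Rightarrow> ('k, 'r, 'r) tens"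
  counit :: "'r \<Rightarrow> 'k"
  grade :: "nat \<Rightarrow> 'r set"

text \<open>
  Bialgebras in the braided category of Yetter-Drinfeld modules: all structure maps are morphisms
  there, and the coproduct is multiplicative for the braided tensor product algebra.
\<close>

definition braided_bialgebra ::
  "('k::field, 'j::ab_group_add, 'y) hopf_scheme
     \<Rightarrow> ('k, 'r::ab_group_add, 'j, 'z) graded_yd_scheme \<Rightarrow> bool" where
  "braided_bialgebra J R \<longleftrightarrow> yd_module J R
     \<and> is_algebra R (mul R) (unit R) \<and> is_coalgebra R (comul R) (counit R)
     \<and> yd_hom J (yd_tensor J R R) R (\<lambda>t. sweedler R R t (mul R))
     \<and> yd_hom J (yd_unit J) R (\<lambda>c. scale R c (unit R))
     \<and> yd_hom J R (yd_tensor J R R) (comul R)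
     \<and> yd_hom J R (yd_unit J) (counit R)
     \<and> (\<forall>r\<in>carrier R. \<forall>s\<in>carrier R. comul R (mul R r s) =
          sweedler R R (comul R r) (\<lambda>r\<^sub>1 r\<^sub>2. sweedler R R (comul R s) (\<lambda>s\<^sub>1 s\<^sub>2.
            sweedler R R (braiding J R R (tens R R r\<^sub>2 s\<^sub>1)) (\<lambda>s' r'.
              tens R R (mul R r\<^sub>1 s') (mul R r' s\<^sub>2)))))
     \<and> comul R (unit R) = tens R R (unit R) (unit R)
     \<and> (\<forall>r\<in>carrier R. \<forall>s\<in>carrier R. counit R (mul R r s) = counit R r * counit R s)
     \<and> counit R (unit R) = 1"

definition graded_space ::
  "('k::field, 'r::ab_group_add, 'z) vec_scheme \<Rightarrow> (nat \<Rightarrow> 'r set) \<Rightarrow> bool" where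
  "graded_space R G \<longleftrightarrow> (\<forall>n. is_subspace R (G n))
     \<and> (\<forall>r\<in>carrier R. \<exists>!f. (\<forall>n. f n \<in> G n) \<and> finite {n. f n \<noteq> 0} \<and> r = (\<Sum>n | f n \<noteq> 0. f n))"

definition graded_braided_bialgebra ::
  "('k::field, 'j::ab_group_add, 'y) hopf_scheme
     \<Rightarrow> ('k, 'r::ab_group_add, 'j, 'z) graded_yd_scheme \<Rightarrow> bool" where
  "graded_braided_bialgebra J R \<longleftrightarrow> braided_bialgebra J R \<and> graded_space R (grade R)
     \<and> (\<forall>n. \<forall>r\<in>grade R n. (\<forall>a\<in>carrier J. act R a r \<in> grade R n)
          \<and> coact R r \<in> tens_sub J R (carrier J) (grade R n))
     \<and> unit R \<in> grade R 0
     \<and> (\<forall>m n. \<forall>r\<in>grade R m. \<forall>s\<in>grade R n. mul R r s \<in> grade R (m + n))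
     \<and> (\<forall>n. \<forall>r\<in>grade R n. \<exists>u. (\<forall>i\<le>n. u i \<in> tens_sub R R (grade R i) (grade R (n - i)))
          \<and> comul R r = (\<Sum>i\<le>n. u i))
     \<and> (\<forall>n>0. \<forall>r\<in>grade R n. counit R r = 0)"

text \<open>
  The identification of \<open>V\<close> with the degree one part is the Yetter-Drinfeld isomorphism \<open>\<iota>\<close>.
\<close>

definition pre_nichols ::
  "('k::field, 'j::ab_group_add, 'x) hopf_scheme \<Rightarrow> ('k, 'v::ab_group_add, 'j, 'y) yd_scheme
     \<Rightarrow> ('k, 'r::ab_group_add, 'j, 'z) graded_yd_scheme \<Rightarrow> ('v \<Rightarrow> 'r) \<Rightarrow> bool" where
  "pre_nichols J V R \<iota> \<longleftrightarrow> graded_braided_bialgebra J R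
     \<and> grade R 0 = {scale R c (unit R) | c. True}
     \<and> yd_hom J V R \<iota> \<and> bij_betw \<iota> (carrier V) (grade R 1)
     \<and> (\<forall>U. is_subspace R U \<and> unit R \<in> U \<and> (\<forall>x\<in>U. \<forall>y\<in>U. mul R x y \<in> U) \<and> grade R 1 \<subseteq> U
          \<longrightarrow> U = carrier R)"

definition primitives :: "('k::field, 'r::ab_group_add, 'j, 'z) graded_yd_scheme \<Rightarrow> 'r set" where
  "primitives R = {r \<in> carrier R. comul R r = tens R R r (unit R) + tens R R (unit R) r}"

definition nichols ::
  "('k::field, 'j::ab_group_add, 'x) hopf_scheme \<Rightarrow> ('k, 'v::ab_group_add, 'j, 'y) yd_scheme
     \<Rightarrow> ('k, 'r::ab_group_add, 'j, 'z) graded_yd_scheme \<Rightarrow> ('v \<Rightarrow> 'r) \<Rightarrow> bool" where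
  "nichols J V R \<iota> \<longleftrightarrow> pre_nichols J V R \<iota> \<and> grade R 1 = primitives R"


section \<open>Bosonization and skew pairings\<close>

text \<open>
  Only the bialgebra structure of the bosonization is recorded: its antipode is determined by it
  and does not occur in the axioms of a skew pairing.
\<close>

definition bosonization ::
  "('k::field, 'r::ab_group_add, 'j::ab_group_add, 'y) graded_yd_scheme \<Rightarrow> ('k, 'j, 'z) hopf_scheme
     \<Rightarrow> ('k, ('k, 'r, 'j) tens) bialgebra" where
  "bosonization R J = (let A = tensor R J in
     \<lparr>carrier = carrier A, scale = scale A,
      hmul = (\<lambda>t u. sweedler R J t (\<lambda>r a. sweedler R J u (\<lambda>s b.
        sweedler J J (hcomul J a) (\<lambda>a\<^sub>1 a\<^sub>2. tens R J (mul R r (act R a\<^sub>1 s)) (hmul J a\<^sub>2 b))))),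
      hone = tens R J (unit R) (hone J),
      hcomul = (\<lambda>t. sweedler R J t (\<lambda>r a. sweedler R R (comul R r) (\<lambda>r\<^sub>1 r\<^sub>2.
        sweedler J R (coact R r\<^sub>2) (\<lambda>j r'. sweedler J J (hcomul J a) (\<lambda>a\<^sub>1 a\<^sub>2.
          tens A A (tens R J r\<^sub>1 (hmul J j a\<^sub>1)) (tens R J r' a\<^sub>2)))))),
      hcounit = (\<lambda>t. sweedler R J t (\<lambda>r a. counit R r * hcounit J a))\<rparr>)"

text \<open>A linear form on a tensor product is given as a bilinear form on the factors.\<close>

definition skew_pairing ::
  "('k::field, 'a::ab_group_add, 'y) bialgebra_scheme \<Rightarrow> ('k, 'x::ab_group_add, 'z) bialgebra_scheme
     \<Rightarrow> ('a \<Rightarrow> 'x \<Rightarrow> 'k) \<Rightarrow> bool" where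
  "skew_pairing A X \<tau> \<longleftrightarrow> bilin A X ground \<tau>
     \<and> (\<forall>a\<in>carrier A. \<forall>b\<in>carrier A. \<forall>x\<in>carrier X.
          \<tau> (hmul A a b) x = sweedler X X (hcomul X x) (\<lambda>x\<^sub>1 x\<^sub>2. \<tau> a x\<^sub>1 * \<tau> b x\<^sub>2))
     \<and> (\<forall>a\<in>carrier A. \<forall>x\<in>carrier X. \<forall>y\<in>carrier X.
          \<tau> a (hmul X x y) = sweedler A A (hcomul A a) (\<lambda>a\<^sub>1 a\<^sub>2. \<tau> a\<^sub>1 y * \<tau> a\<^sub>2 x))
     \<and> (\<forall>x\<in>carrier X. \<tau> (hone A) x = hcounit X x)
     \<and> (\<forall>a\<in>carrier A. \<tau> a (hone X) = hcounit A a)"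

definition compatible_form ::
  "('k::field, 'j::ab_group_add, 'a) hopf_scheme \<Rightarrow> ('k, 'l::ab_group_add, 'b) hopf_scheme
     \<Rightarrow> ('j \<Rightarrow> 'l \<Rightarrow> 'k) \<Rightarrow> ('k, 'v::ab_group_add, 'j, 'c) yd_scheme
     \<Rightarrow> ('k, 'w::ab_group_add, 'l, 'd) yd_scheme \<Rightarrow> ('v \<Rightarrow> 'w \<Rightarrow> 'k) \<Rightarrow> bool" where
  "compatible_form J K \<tau>\<^sub>0 V W \<tau>\<^sub>1 \<longleftrightarrow> bilin V W ground \<tau>\<^sub>1
     \<and> (\<forall>a\<in>carrier J. \<forall>v\<in>carrier V. \<forall>w\<in>carrier W.
          \<tau>\<^sub>1 (act V a v) w = sweedler K W (coact W w) (\<lambda>x w'. \<tau>\<^sub>0 a x * \<tau>\<^sub>1 v w'))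
     \<and> (\<forall>x\<in>carrier K. \<forall>v\<in>carrier V. \<forall>w\<in>carrier W.
          \<tau>\<^sub>1 v (act W x w) = sweedler J V (coact V v) (\<lambda>j v'. \<tau>\<^sub>0 j (antipode K x) * \<tau>\<^sub>1 v' w))"

text \<open>
  The skew pairing of the bosonizations extending \<open>\<tau>\<^sub>0\<close> and \<open>\<tau>\<^sub>1\<close>, where \<open>V\<close> and \<open>W\<close> are
  embedded by \<open>\<iota>\<close> and \<open>\<kappa>\<close>.
\<close>

definition extended_pairing ::
  "('k::field, 'j::ab_group_add, 'a) hopf_scheme \<Rightarrow> ('k, 'l::ab_group_add, 'b) hopf_scheme
     \<Rightarrow> ('j \<Rightarrow> 'l \<Rightarrow> 'k) \<Rightarrow> ('k, 'v::ab_group_add, 'j, 'c) yd_scheme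
     \<Rightarrow> ('k, 'w::ab_group_add, 'l, 'd) yd_scheme \<Rightarrow> ('v \<Rightarrow> 'w \<Rightarrow> 'k)
     \<Rightarrow> ('k, 'r::ab_group_add, 'j, 'e) graded_yd_scheme \<Rightarrow> ('v \<Rightarrow> 'r)
     \<Rightarrow> ('k, 's::ab_group_add, 'l, 'f) graded_yd_scheme \<Rightarrow> ('w \<Rightarrow> 's)
     \<Rightarrow> (('k, 'r, 'j) tens \<Rightarrow> ('k, 's, 'l) tens \<Rightarrow> 'k) \<Rightarrow> bool" where
  "extended_pairing J K \<tau>\<^sub>0 V W \<tau>\<^sub>1 R \<iota> S \<kappa> \<tau> \<longleftrightarrow>
     skew_pairing (bosonization R J) (bosonization S K) \<tau>
     \<and> (\<forall>a\<in>carrier J. \<forall>x\<in>carrier K. \<tau> (tens R J (unit R) a) (tens S K (unit S) x) = \<tau>\<^sub>0 a x)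
     \<and> (\<forall>v\<in>carrier V. \<forall>w\<in>carrier W. \<tau> (tens R J (\<iota> v) (hone J)) (tens S K (\<kappa> w) (hone K)) = \<tau>\<^sub>1 v w)
     \<and> (\<forall>a\<in>carrier J. \<forall>w\<in>carrier W. \<tau> (tens R J (unit R) a) (tens S K (\<kappa> w) (hone K)) = 0)
     \<and> (\<forall>v\<in>carrier V. \<forall>x\<in>carrier K. \<tau> (tens R J (\<iota> v) (hone J)) (tens S K (unit S) x) = 0)"


section \<open>The generalized q-boson algebra\<close>

text \<open>
  The following properties determine the multiplication \<open>m\<close> on the tensor product of \<open>R\<close> and
  \<open>S\<close>, and the action of the resulting algebra on \<open>R\<close>.
\<close>

definition q_boson_algebra ::
  "('k::field, 'j::ab_group_add, 'a) hopf_scheme \<Rightarrow> ('k, 'l::ab_group_add, 'b) hopf_scheme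
     \<Rightarrow> ('j \<Rightarrow> 'l \<Rightarrow> 'k) \<Rightarrow> ('k, 'v::ab_group_add, 'j, 'c) yd_scheme
     \<Rightarrow> ('k, 'w::ab_group_add, 'l, 'd) yd_scheme \<Rightarrow> ('v \<Rightarrow> 'w \<Rightarrow> 'k)
     \<Rightarrow> ('k, 'r::ab_group_add, 'j, 'e) graded_yd_scheme \<Rightarrow> ('v \<Rightarrow> 'r)
     \<Rightarrow> ('k, 's::ab_group_add, 'l, 'f) graded_yd_scheme \<Rightarrow> ('w \<Rightarrow> 's)
     \<Rightarrow> (('k, 'r, 's) tens \<Rightarrow> ('k, 'r, 's) tens \<Rightarrow> ('k, 'r, 's) tens) \<Rightarrow> bool" where
  "q_boson_algebra J K \<tau>\<^sub>0 V W \<tau>\<^sub>1 R \<iota> S \<kappa> m \<longleftrightarrow>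
     is_algebra (tensor R S) m (tens R S (unit R) (unit S))
     \<and> (\<forall>r\<in>carrier R. \<forall>r'\<in>carrier R.
          m (tens R S r (unit S)) (tens R S r' (unit S)) = tens R S (mul R r r') (unit S))
     \<and> (\<forall>s\<in>carrier S. \<forall>s'\<in>carrier S.
          m (tens R S (unit R) s) (tens R S (unit R) s') = tens R S (unit R) (mul S s s'))
     \<and> (\<forall>r\<in>carrier R. \<forall>s\<in>carrier S. m (tens R S r (unit S)) (tens R S (unit R) s) = tens R S r s)
     \<and> (\<forall>v\<in>carrier V. \<forall>w\<in>carrier W.
          m (tens R S (unit R) (\<kappa> w)) (tens R S (\<iota> v) (unit S)) =
            sweedler J V (coact V v) (\<lambda>j v'. sweedler K W (coact W w) (\<lambda>x w'.
              scale (tensor R S) (\<tau>\<^sub>0 j x) (tens R S (\<iota> v') (\<kappa> w'))))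
            + scale (tensor R S) (\<tau>\<^sub>1 v w) (tens R S (unit R) (unit S)))"

definition q_boson_action ::
  "('k::field, 'j::ab_group_add, 'a) hopf_scheme \<Rightarrow> ('k, 'l::ab_group_add, 'b) hopf_scheme
     \<Rightarrow> ('k, 'r::ab_group_add, 'j, 'e) graded_yd_scheme
     \<Rightarrow> ('k, 's::ab_group_add, 'l, 'f) graded_yd_scheme
     \<Rightarrow> (('k, 'r, 'j) tens \<Rightarrow> ('k, 's, 'l) tens \<Rightarrow> 'k)
     \<Rightarrow> (('k, 'r, 's) tens \<Rightarrow> ('k, 'r, 's) tens \<Rightarrow> ('k, 'r, 's) tens)
     \<Rightarrow> (('k, 'r, 's) tens \<Rightarrow> 'r \<Rightarrow> 'r) \<Rightarrow> bool" where
  "q_boson_action J K R S \<tau> m ac \<longleftrightarrow>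
     left_module (tensor R S) m (tens R S (unit R) (unit S)) R ac
     \<and> (\<forall>r\<in>carrier R. \<forall>r'\<in>carrier R. ac (tens R S r (unit S)) r' = mul R r r')
     \<and> (\<forall>s\<in>carrier S. \<forall>r\<in>carrier R. ac (tens R S (unit R) s) r =
          sweedler R R (comul R r) (\<lambda>r\<^sub>1 r\<^sub>2.
            scale R (\<tau> (tens R J r\<^sub>1 (hone J)) (tens S K s (hone K))) r\<^sub>2))"

end

theory Submission
  imports Defs
begin

text \<open>
  Each \<open>w\<close> in \<open>W\<close> acts on \<open>R\<close> by contracting the first tensor factor of the coproduct with the
  functional \<open>\<psi>\<^sub>w = \<tau>(-, w)\<close>.  This vanishes on \<open>R(0)\<close>, so the action lowers the filtration by degree,
  and a nonzero element of minimal filtration degree in a submodule is killed by all \<open>w\<close>.  It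
  remains to see that an \<open>x\<close> killed by all \<open>w\<close> is a scalar.  For a functional \<open>\<phi>\<close> vanishing on \<open>R(0)\<close>,
  the contraction of the second factor of \<open>\<Delta>(x)\<close> with \<open>\<phi>\<close> has lower filtration degree and by
  coassociativity is again killed by all \<open>w\<close>, hence is a scalar by induction.  As \<open>\<phi>\<close> varies this
  says that \<open>x - \<epsilon>(x)1\<close> is primitive, so it lies in \<open>R(1) = V\<close>, where \<open>w\<close> acts as \<open>\<tau>\<^sub>1(-, w)\<close>, and
  injectivity of \<open>\<tau>\<^sub>1\<^sup>l\<close> makes it zero.
\<close>

section \<open>Linear maps and subspaces relative to a carrier\<close>

lemma lin_sum:
  assumes "lin A B f" "vec_space A" "finite I" "\<And>i. i \<in> I \<Longrightarrow> g i \<in> carrier A"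
  shows "(\<Sum>i\<in>I. g i) \<in> carrier A \<and> f (\<Sum>i\<in>I. g i) = (\<Sum>i\<in>I. f (g i))"
proof -
  have z: "0 \<in> carrier A" using assms(2) by (auto simp: vec_space_def is_subspace_def)
  then have "f (0 + 0) = f 0 + f 0" using assms(1) unfolding lin_def by blast
  then have "f 0 = 0" by simp
  from assms(3,4) this z show ?thesis
  proof (induction I)
    case (insert i I)
    then show ?case using assms(1,2) by (simp add: lin_def vec_space_def is_subspace_def)
  qed simp
qed

lemma is_subspace_sum:
  assumes "is_subspace A U" "finite I" "\<And>i. i \<in> I \<Longrightarrow> g i \<in> U"
  shows "(\<Sum>i\<in>I. g i) \<in> U"
  using assms(2,3) assms(1) by (induction I) (auto simp: is_subspace_def)

lemma is_subspace_diff: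
  assumes "vec_space A" "is_subspace A U" "x \<in> U" "y \<in> U"
  shows "x - y \<in> U"
proof -
  interpret vector_space "scale A" using assms(1) by (simp add: vec_space_def)
  have "x + scale A (-1) y \<in> U" using assms(2-4) unfolding is_subspace_def by blast
  then show ?thesis by simp
qed

lemma lin_diff:
  assumes "lin A B f" "vec_space A" "x \<in> carrier A" "y \<in> carrier A"
  shows "f (x - y) = f x - f y"
proof -
  have "x - y \<in> carrier A" using assms is_subspace_diff vec_space_def by blast
  then have "f (x - y + y) = f (x - y) + f y" using assms(1,4) unfolding lin_def by blast
  then show ?thesis by simp
qed

lemma lin_zero:
  assumes "lin A B f" "vec_space A"
  shows "f 0 = 0"
  using lin_sum[OF assms, of "{}"] by simp

section \<open>Sums over presentations of a tensor\<close>

lemma tensor_carrierE: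
  assumes "t \<in> carrier (tensor A B)"
  obtains xs where "set xs \<subseteq> carrier A \<times> carrier B" "t = tens_sum A B xs"
  using assms by (auto simp: tensor_def tens_sub_def)

lemma tens_sub_mono:
  "X \<subseteq> X' \<Longrightarrow> Y \<subseteq> Y' \<Longrightarrow> tens_sub A B X Y \<subseteq> tens_sub A B X' Y'"
  unfolding tens_sub_def by blast

lemma sweedler_in_subspace:
  assumes "bilin A B C f" "vec_space C" "is_subspace C U"
    and "t \<in> tens_sub A B X Y" "X \<subseteq> carrier A" "Y \<subseteq> carrier B"
    and U: "\<And>a b. a \<in> X \<Longrightarrow> b \<in> Y \<Longrightarrow> f a b \<in> U"
  shows "sweedler A B t f \<in> U"
proof -
  obtain xs where xs: "set xs \<subseteq> X \<times> Y" "t = tens_sum A B xs"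
    using assms(4) by (auto simp: tens_sub_def)
  have "sweedler A B t f = (\<Sum>(a, b)\<leftarrow>xs. f a b)"
    unfolding xs(2) using assms(1,2) by (rule sweedler_sum_tens) (use xs(1) assms(5,6) in blast)
  moreover have "(\<Sum>(a, b)\<leftarrow>xs. f a b) \<in> U"
    using xs(1) assms(3) U by (induction xs) (auto simp: is_subspace_def)
  ultimately show ?thesis by simp
qed

text \<open>The list that \<open>sweedler\<close> chooses depends on \<open>t\<close> alone, so one
  list serves every integrand, bilinear or not. The formula appears at two result types because an
  obtained fact is monomorphic and \<open>sweedler_comp\<close> compares sums in two spaces.\<close>

lemma sweedler_presentation:
  assumes "t \<in> carrier (tensor A B)"
  obtains xs where "set xs \<subseteq> carrier A \<times> carrier B"
    "\<And>f :: _ \<Rightarrow> _ \<Rightarrow> 'c::ab_group_add. sweedler A B t f = (\<Sum>(a, b)\<leftarrow>xs. f a b)"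
    "\<And>f :: _ \<Rightarrow> _ \<Rightarrow> 'd::ab_group_add. sweedler A B t f = (\<Sum>(a, b)\<leftarrow>xs. f a b)"
proof -
  let ?P = "\<lambda>xs. set xs \<subseteq> carrier A \<times> carrier B \<and> tens_sum A B xs = t"
  have "\<exists>xs. ?P xs" using assms tensor_carrierE by metis
  then have "?P (SOME xs. ?P xs)" by (rule someI_ex)
  then show ?thesis using that unfolding sweedler_def by blast
qed

text \<open>Both sides are sums over the same list, so \<open>f\<close> may be any function into
  \<open>C\<close>, in particular an inner Sweedler sum whose bilinearity would call for its own
  proof.\<close>

lemma sweedler_comp:
  fixes f :: "'a::ab_group_add \<Rightarrow> 'b::ab_group_add \<Rightarrow> 'c::ab_group_add"
    and g :: "'c \<Rightarrow> 'd::ab_group_add"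
  assumes t: "t \<in> carrier (tensor A B)" and g: "lin C D g" "vec_space C"
    and f: "\<And>a b. a \<in> carrier A \<Longrightarrow> b \<in> carrier B \<Longrightarrow> f a b \<in> carrier C"
  shows "g (sweedler A B t f) = sweedler A B t (\<lambda>a b. g (f a b))"
proof -
  obtain xs where xs: "set xs \<subseteq> carrier A \<times> carrier B"
      "\<And>f. sweedler A B t f = (\<Sum>(a, b)\<leftarrow>xs. f a b :: 'c)"
      "\<And>f. sweedler A B t f = (\<Sum>(a, b)\<leftarrow>xs. f a b :: 'd)"
    using t by (rule sweedler_presentation) blast
  have "(\<Sum>(a, b)\<leftarrow>xs. f a b) \<in> carrier C \<and>
      g (\<Sum>(a, b)\<leftarrow>xs. f a b) = (\<Sum>(a, b)\<leftarrow>xs. g (f a b))"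
    using xs(1)
  proof (induction xs)
    case Nil
    then show ?case using g(2) lin_zero[OF g] by (simp add: vec_space_def is_subspace_def)
  next
    case (Cons p xs)
    then show ?case using g f[of "fst p" "snd p"]
      by (auto simp: lin_def vec_space_def is_subspace_def)
  qed
  then show ?thesis by (simp add: xs(2,3))
qed

lemma sweedler_cong:
  fixes f g :: "'a::ab_group_add \<Rightarrow> 'b::ab_group_add \<Rightarrow> 'c::ab_group_add"
  assumes "t \<in> carrier (tensor A B)"
    and "\<And>a b. a \<in> carrier A \<Longrightarrow> b \<in> carrier B \<Longrightarrow> f a b = g a b"
  shows "sweedler A B t f = sweedler A B t g"
proof -
  obtain xs where xs: "set xs \<subseteq> carrier A \<times> carrier B"
      "\<And>f. sweedler A B t f = (\<Sum>(a, b)\<leftarrow>xs. f a b :: 'c)"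
    using assms(1) by (rule sweedler_presentation) blast
  have "(\<Sum>(a, b)\<leftarrow>xs. f a b) = (\<Sum>(a, b)\<leftarrow>xs. g a b)"
    using xs(1) assms(2) by (induction xs) auto
  then show ?thesis by (simp add: xs(2))
qed

lemma sweedler_diff:
  fixes f g :: "'a::ab_group_add \<Rightarrow> 'b::ab_group_add \<Rightarrow> 'c::ab_group_add"
  assumes "t \<in> carrier (tensor A B)"
  shows "sweedler A B t (\<lambda>a b. f a b - g a b) = sweedler A B t f - sweedler A B t g"
proof -
  obtain xs where xs: "\<And>f. sweedler A B t f = (\<Sum>(a, b)\<leftarrow>xs. f a b :: 'c)"
    using assms by (rule sweedler_presentation) blast
  have "(\<Sum>(a, b)\<leftarrow>xs. f a b - g a b) = (\<Sum>(a, b)\<leftarrow>xs. f a b) - (\<Sum>(a, b)\<leftarrow>xs. g a b)"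
    by (induction xs) auto
  then show ?thesis by (simp add: xs)
qed

lemma sweedler_closed:
  fixes f :: "'a::ab_group_add \<Rightarrow> 'b::ab_group_add \<Rightarrow> 'c::ab_group_add"
  assumes "t \<in> carrier (tensor A B)" "vec_space C"
    and "\<And>a b. a \<in> carrier A \<Longrightarrow> b \<in> carrier B \<Longrightarrow> f a b \<in> carrier C"
  shows "sweedler A B t f \<in> carrier C"
proof -
  obtain xs where xs: "set xs \<subseteq> carrier A \<times> carrier B"
      "\<And>f. sweedler A B t f = (\<Sum>(a, b)\<leftarrow>xs. f a b :: 'c)"
    using assms(1) by (rule sweedler_presentation) blast
  have "(\<Sum>(a, b)\<leftarrow>xs. f a b) \<in> carrier C"
    using xs(1) assms(2,3) by (induction xs) (auto simp: vec_space_def is_subspace_def)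
  then show ?thesis by (simp add: xs(2))
qed

section \<open>Contracting one tensor factor with a functional\<close>

lemma lin_comp: "lin A B f \<Longrightarrow> lin B C g \<Longrightarrow> lin A C (\<lambda>x. g (f x))"
  by (simp add: lin_def)

lemma lin_scale:
  assumes "vec_space A"
  shows "lin A A (scale A c)"
proof -
  interpret vector_space "scale A" using assms by (simp add: vec_space_def)
  show ?thesis using assms
    by (auto simp: lin_def vec_space_def is_subspace_def scale_right_distrib mult.commute)
qed

lemma bilin_scale_left:
  assumes "lin A ground \<psi>" "vec_space B"
  shows "bilin A B B (\<lambda>a b. scale B (\<psi> a) b)"
proof -
  interpret vector_space "scale B" using assms(2) by (simp add: vec_space_def)
  show ?thesis using assms unfolding bilin_def lin_def vec_space_def is_subspace_def ground_def
    by (auto simp: scale_left_distrib scale_right_distrib mult.commute)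
qed

lemma bilin_scale_right:
  assumes "lin B ground \<phi>" "vec_space A"
  shows "bilin A B A (\<lambda>a b. scale A (\<phi> b) a)"
proof -
  interpret vector_space "scale A" using assms(2) by (simp add: vec_space_def)
  show ?thesis using assms unfolding bilin_def lin_def vec_space_def is_subspace_def ground_def
    by (auto simp: scale_left_distrib scale_right_distrib mult.commute)
qed

text \<open>Coordinate functionals do the work: with a basis of \<open>B\<close>, a tensor is the
  sum over basis vectors \<open>e\<close> of its slice at the coordinate of \<open>e\<close>,
  tensored with \<open>e\<close>. Equal slices therefore give equal tensors.\<close>

lemma tensor_eq_by_slices:
  assumes A: "vec_space A" and B: "vec_space B"
    and t: "t \<in> carrier (tensor A B)" and u: "u \<in> carrier (tensor A B)"
    and eq: "\<And>\<phi>. lin B ground \<phi> \<Longrightarrow> sweedler A B t (\<lambda>a b. scale A (\<phi> b) a) = sweedler A B u (\<lambda>a b. scale A (\<phi> b) a)"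
  shows "t = u"
proof -
  interpret A: vector_space "scale A" using A by (simp add: vec_space_def)
  interpret B: vector_space "scale B" using B by (simp add: vec_space_def)
  have sub: "B.subspace (carrier B)"
    using B unfolding vec_space_def is_subspace_def B.subspace_def by auto
  obtain E where E: "E \<subseteq> carrier B" "B.independent E" "carrier B \<subseteq> B.span E"
    using B.maximal_independent_subset by blast
  let ?\<phi> = "\<lambda>e b. B.representation E b e"
  have \<phi>: "lin B ground (?\<phi> e)" for e
    using E by (auto simp: lin_def ground_def B.representation_add B.representation_scale subsetD)
  let ?s = "\<lambda>e t. sweedler A B t (\<lambda>a b. scale A (?\<phi> e b) a)"
  obtain xs where xs: "set xs \<subseteq> carrier A \<times> carrier B" "t = tens_sum A B xs"
    using t by (rule tensor_carrierE)
  obtain ys where ys: "set ys \<subseteq> carrier A \<times> carrier B" "u = tens_sum A B ys"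
    using u by (rule tensor_carrierE)
  \<comment> \<open>The basis vectors with a nonzero coordinate in some second entry of
    \<open>xs\<close> or \<open>ys\<close>. This one finite set serves both tensors.\<close>
  define I where "I = (\<Union>p\<in>set (xs @ ys). {e. ?\<phi> e (snd p) \<noteq> 0})"
  have "finite I" unfolding I_def by (auto simp: B.finite_representation)
  have IE: "I \<subseteq> carrier B"
    unfolding I_def using E(1) B.representation_ne_zero by blast
  \<comment> \<open>The basis expansion of a tensor, evaluated at a bilinear form. Bounding
    \<open>zs\<close> by \<open>xs @ ys\<close> keeps all coordinates inside \<open>I\<close> and is
    inherited by tails, as the induction requires.\<close>
  have expand: "tens_sum A B zs \<beta> = (\<Sum>e\<in>I. \<beta> (?s e (tens_sum A B zs)) e)"
    if \<beta>: "bilin A B ground \<beta>" and zs: "set zs \<subseteq> set (xs @ ys)" for zs \<beta>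
  proof -
    have zs': "set zs \<subseteq> carrier A \<times> carrier B" using zs xs(1) ys(1) by auto
    have "?s e (tens_sum A B zs) = (\<Sum>(a, b)\<leftarrow>zs. scale A (?\<phi> e b) a)" for e
      by (rule sweedler_sum_tens[OF bilin_scale_right[OF \<phi> A] A zs'])
    \<comment> \<open>Membership in \<open>carrier A\<close> is proved along with the formula, since
      additivity of \<beta> in its first argument is known on the carrier only.\<close>
    moreover have "(\<Sum>(a, b)\<leftarrow>zs. scale A (?\<phi> e b) a) \<in> carrier A \<and> tens_sum A B zs \<beta> =
        (\<Sum>e\<in>I. \<beta> (\<Sum>(a, b)\<leftarrow>zs. scale A (?\<phi> e b) a) e)" for e
      using zs zs'
    proof (induction zs arbitrary: e)
      case Nil
      have "\<beta> 0 e = 0" if "e \<in> I" for e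
        using \<beta> IE that lin_zero[OF _ A, of ground "\<lambda>a. \<beta> a e"] by (auto simp: bilin_def)
      then show ?case using A by (simp add: tens_sum_def vec_space_def is_subspace_def)
    next
      case (Cons p zs)
      obtain a b where p: "p = (a, b)" by (cases p)
      have ab: "a \<in> carrier A" "b \<in> carrier B" using Cons.prems p by auto
      have sa: "scale A c a \<in> carrier A" for c
        using A ab by (simp add: vec_space_def is_subspace_def)
      have supp: "{e. ?\<phi> e b \<noteq> 0} \<subseteq> I" using Cons.prems(1) p unfolding I_def by force
      have "b = (\<Sum>e | ?\<phi> e b \<noteq> 0. scale B (?\<phi> e b) e)"
        using B.sum_nonzero_representation_eq[OF E(2), of b] E(3) ab(2) by auto
      also have "\<dots> = (\<Sum>e\<in>I. scale B (?\<phi> e b) e)"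
        using supp \<open>finite I\<close> by (intro sum.mono_neutral_left) auto
      finally have "\<beta> a b = \<beta> a (\<Sum>e\<in>I. scale B (?\<phi> e b) e)" by simp
      also have "\<dots> = (\<Sum>e\<in>I. \<beta> a (scale B (?\<phi> e b) e))"
      proof (rule conjunct2[OF lin_sum[OF _ B \<open>finite I\<close>]])
        show "lin B ground (\<beta> a)" using \<beta> ab(1) by (simp add: bilin_def)
      qed (use B IE in \<open>auto simp: vec_space_def is_subspace_def\<close>)
      \<comment> \<open>Bilinearity moves the coordinates of \<open>b\<close> into the first
        argument, where the slices collect them.\<close>
      also have "\<dots> = (\<Sum>e\<in>I. \<beta> (scale A (?\<phi> e b) a) e)"
        using \<beta> ab IE by (intro sum.cong) (auto simp: bilin_def lin_def)
      finally have ab': "\<beta> a b = (\<Sum>e\<in>I. \<beta> (scale A (?\<phi> e b) a) e)" .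
      have IH: "(\<Sum>(a, b)\<leftarrow>zs. scale A (?\<phi> e b) a) \<in> carrier A"
        "tens_sum A B zs \<beta> = (\<Sum>e\<in>I. \<beta> (\<Sum>(a, b)\<leftarrow>zs. scale A (?\<phi> e b) a) e)" for e
        using Cons by auto
      have add: "\<beta> (scale A (?\<phi> e b) a + (\<Sum>(a, b)\<leftarrow>zs. scale A (?\<phi> e b) a)) e =
          \<beta> (scale A (?\<phi> e b) a) e + \<beta> (\<Sum>(a, b)\<leftarrow>zs. scale A (?\<phi> e b) a) e" if "e \<in> I" for e
        using \<beta> that IE sa IH(1) unfolding bilin_def lin_def by blast
      have "tens_sum A B (p # zs) \<beta> = \<beta> a b + tens_sum A B zs \<beta>"
        using \<beta> by (simp add: p tens_sum_def tens_def)
      also have "\<dots> = (\<Sum>e\<in>I. \<beta> (scale A (?\<phi> e b) a) e + \<beta> (\<Sum>(a, b)\<leftarrow>zs. scale A (?\<phi> e b) a) e)"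
        unfolding IH(2) ab' by (rule sum.distrib[symmetric])
      also have "\<dots> = (\<Sum>e\<in>I. \<beta> (scale A (?\<phi> e b) a + (\<Sum>(a, b)\<leftarrow>zs. scale A (?\<phi> e b) a)) e)"
        by (intro sum.cong) (simp_all only: add)
      finally show ?case using sa[of "?\<phi> e b"] IH(1)[of e] A
        by (simp add: p vec_space_def is_subspace_def)
    qed
    ultimately show ?thesis by simp
  qed
  have "t \<beta> = u \<beta>" for \<beta>
  proof (cases "bilin A B ground \<beta>")
    case True
    have "t \<beta> = (\<Sum>e\<in>I. \<beta> (?s e t) e)" "u \<beta> = (\<Sum>e\<in>I. \<beta> (?s e u) e)"
      unfolding xs(2) ys(2) by (auto intro!: expand[OF True])
    then show ?thesis by (simp only: eq[OF \<phi>])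
  next
    case False
    \<comment> \<open>By definition \<open>tens\<close> takes the default value 0 at forms that are
      not bilinear, so both tensors vanish there.\<close>
    then have "tens_sum A B zs \<beta> = 0" for zs
      by (induction zs) (auto simp: tens_sum_def tens_def)
    then show ?thesis using xs(2) ys(2) by simp
  qed
  then show ?thesis by blast
qed

section \<open>Connected coalgebras and contractions of their coproduct\<close>

locale connected_coalgebra =
  fixes A :: "('k::field, 'a::ab_group_add, 'z) vec_scheme"
    and \<Delta> :: "'a \<Rightarrow> ('k, 'a, 'a) tens" and \<epsilon> :: "'a \<Rightarrow> 'k" and e :: 'a and G :: "nat \<Rightarrow> 'a set"
  assumes coalgebra: "is_coalgebra A \<Delta> \<epsilon>"
    and e_carrier: "e \<in> carrier A" and counit_e: "\<epsilon> e = 1" and comul_e: "\<Delta> e = tens A A e e"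
    and G_subspace: "is_subspace A (G n)"
    and G_0: "G 0 = {scale A c e | c. True}"
    and comul_G: "r \<in> G n \<Longrightarrow>
      \<exists>u. (\<forall>i\<le>n. u i \<in> tens_sub A A (G i) (G (n - i))) \<and> \<Delta> r = (\<Sum>i\<le>n. u i)"
    and G_exhaust: "r \<in> carrier A \<Longrightarrow> \<exists>f n. (\<forall>i. f i \<in> G i) \<and> r = (\<Sum>i<n. f i)"
begin

lemma space: "vec_space A"
  using coalgebra by (simp add: is_coalgebra_def)

lemma carrier_subspace: "is_subspace A (carrier A)"
  using space by (simp add: vec_space_def)

sublocale vs: vector_space "scale A"
  using space by (simp add: vec_space_def)

lemma lin_comul: "lin A (tensor A A) \<Delta>" and lin_counit: "lin A ground \<epsilon>"
  using coalgebra by (auto simp: is_coalgebra_def)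

lemma comul_carrier: "x \<in> carrier A \<Longrightarrow> \<Delta> x \<in> carrier (tensor A A)"
  using lin_comul by (simp add: lin_def)

lemma scale_carrier: "x \<in> carrier A \<Longrightarrow> scale A c x \<in> carrier A"
  using carrier_subspace by (simp add: is_subspace_def)

text \<open>For the functional \<tau>(-, w) this is the action of \<open>w\<close> in the q-boson
  algebra. Its mirror image \<open>rslice\<close> serves to detect primitive elements.\<close>

definition lslice :: "('a \<Rightarrow> 'k) \<Rightarrow> 'a \<Rightarrow> 'a" where
  "lslice \<psi> x = sweedler A A (\<Delta> x) (\<lambda>a b. scale A (\<psi> a) b)"

definition rslice :: "('a \<Rightarrow> 'k) \<Rightarrow> 'a \<Rightarrow> 'a" where
  "rslice \<phi> x = sweedler A A (\<Delta> x) (\<lambda>a b. scale A (\<phi> b) a)"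

lemma lin_lslice: "lin A ground \<psi> \<Longrightarrow> lin A A (lslice \<psi>)"
  unfolding lslice_def
  by (rule lin_comp[OF lin_comul]) (rule lin_sweedler[OF bilin_scale_left[OF _ space] space space space])

lemma lin_rslice: "lin A ground \<phi> \<Longrightarrow> lin A A (rslice \<phi>)"
  unfolding rslice_def
  by (rule lin_comp[OF lin_comul]) (rule lin_sweedler[OF bilin_scale_right[OF _ space] space space space])

lemma lslice_counit: "x \<in> carrier A \<Longrightarrow> lslice \<epsilon> x = x"
  and rslice_counit: "x \<in> carrier A \<Longrightarrow> rslice \<epsilon> x = x"
  using coalgebra by (auto simp: is_coalgebra_def lslice_def rslice_def)

lemma lslice_e: "lin A ground \<psi> \<Longrightarrow> lslice \<psi> e = scale A (\<psi> e) e"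
  unfolding lslice_def comul_e
  by (rule sweedler_tens[OF bilin_scale_left[OF _ space] space e_carrier e_carrier])

lemma lslice_primitive:
  assumes "lin A ground \<psi>" "x \<in> carrier A" "\<Delta> x = tens A A x e + tens A A e x"
  shows "lslice \<psi> x = scale A (\<psi> x) e + scale A (\<psi> e) x"
proof -
  have "sweedler A A (tens_sum A A [(x, e), (e, x)]) (\<lambda>a b. scale A (\<psi> a) b) =
      scale A (\<psi> x) e + scale A (\<psi> e) x"
    by (subst sweedler_sum_tens[OF bilin_scale_left[OF assms(1) space] space])
      (use assms(2) e_carrier in auto)
  then show ?thesis by (simp add: lslice_def assms(3) tens_sum_def)
qed

text \<open>Coassociativity: both sides are the image of the iterated coproduct under the map
  \<open>?h\<close> sending a \<otimes> b \<otimes> c to \<psi>(a) \<phi>(c) b. Hence right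
  contractions preserve the kernel of a left contraction.\<close>

lemma lslice_rslice:
  assumes \<psi>: "lin A ground \<psi>" and \<phi>: "lin A ground \<phi>" and x: "x \<in> carrier A"
  shows "lslice \<psi> (rslice \<phi> x) = rslice \<phi> (lslice \<psi> x)"
proof -
  let ?AA = "tensor A A"
  let ?cr = "\<lambda>u. sweedler A A u (\<lambda>b c. scale A (\<phi> c) b)"
  let ?h = "\<lambda>T. sweedler A ?AA T (\<lambda>a u. scale A (\<psi> a) (?cr u))"
  note AA = vec_space_tensor[OF space space]
  have cr: "lin ?AA A ?cr"
    by (rule lin_sweedler[OF bilin_scale_right[OF \<phi> space] space space space])
  have bh: "bilin A ?AA A (\<lambda>a u. scale A (\<psi> a) (?cr u))"
  proof -
    have "lin A A (\<lambda>a. scale A (\<psi> a) (?cr u))" if "u \<in> carrier ?AA" for u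
      using bilin_scale_left[OF \<psi> space] cr that by (simp add: bilin_def lin_def)
    moreover have "lin ?AA A (\<lambda>u. scale A (\<psi> a) (?cr u))" for a
      by (rule lin_comp[OF cr lin_scale[OF space]])
    ultimately show ?thesis by (simp add: bilin_def)
  qed
  have h: "lin (tensor A ?AA) A ?h"
    by (rule lin_sweedler[OF bh space space AA])
  have tens_AA: "tens A A a b \<in> carrier ?AA" if "a \<in> carrier A" "b \<in> carrier A" for a b
    using bilin_tens[OF space space] that by (simp add: bilin_def lin_def)
  have t3: "tens3 A A A a b c \<in> carrier (tensor A ?AA)"
    if "a \<in> carrier A" "b \<in> carrier A" "c \<in> carrier A" for a b c
    using bilin_tens[OF space AA] that tens_AA by (simp add: tens3_def bilin_def lin_def)
  have h3: "?h (tens3 A A A a b c) = scale A (\<psi> a) (scale A (\<phi> c) b)"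
    if "a \<in> carrier A" "b \<in> carrier A" "c \<in> carrier A" for a b c
    using that tens_AA unfolding tens3_def
    by (simp add: sweedler_tens[OF bh space] sweedler_tens[OF bilin_scale_right[OF \<phi> space] space])
  note V3 = vec_space_tensor[OF space AA]
  have "lslice \<psi> (rslice \<phi> x) = sweedler A A (\<Delta> x) (\<lambda>a b. lslice \<psi> (scale A (\<phi> b) a))"
    unfolding rslice_def
    by (rule sweedler_comp[OF comul_carrier[OF x] lin_lslice[OF \<psi>] space scale_carrier])
  also have "\<dots> = sweedler A A (\<Delta> x) (\<lambda>a b. ?h (sweedler A A (\<Delta> a) (\<lambda>a1 a2. tens3 A A A a1 a2 b)))"
  proof (rule sweedler_cong[OF comul_carrier[OF x]])
    fix a b assume ab: "a \<in> carrier A" "b \<in> carrier A"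
    have "lslice \<psi> (scale A (\<phi> b) a) = scale A (\<phi> b) (lslice \<psi> a)"
      using lin_lslice[OF \<psi>] ab by (simp add: lin_def)
    also have "\<dots> = sweedler A A (\<Delta> a) (\<lambda>a1 a2. scale A (\<phi> b) (scale A (\<psi> a1) a2))"
      unfolding lslice_def
      by (rule sweedler_comp[OF comul_carrier[OF ab(1)] lin_scale[OF space] space scale_carrier])
    also have "\<dots> = sweedler A A (\<Delta> a) (\<lambda>a1 a2. ?h (tens3 A A A a1 a2 b))"
      by (rule sweedler_cong[OF comul_carrier[OF ab(1)]]) (simp add: h3 ab mult.commute)
    also have "\<dots> = ?h (sweedler A A (\<Delta> a) (\<lambda>a1 a2. tens3 A A A a1 a2 b))"
      by (rule sweedler_comp[OF comul_carrier[OF ab(1)] h V3, symmetric]) (simp add: t3 ab)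
    finally show "lslice \<psi> (scale A (\<phi> b) a) = \<dots>" .
  qed
  also have "\<dots> = ?h (sweedler A A (\<Delta> x) (\<lambda>a b. sweedler A A (\<Delta> a) (\<lambda>a1 a2. tens3 A A A a1 a2 b)))"
    by (rule sweedler_comp[OF comul_carrier[OF x] h V3, symmetric])
      (simp add: sweedler_closed[OF comul_carrier V3] t3)
  \<comment> \<open>Here the coassociativity axiom enters. The chain before it pulls
    \<open>?h\<close> out of the left-hand side, the chain after it pushes \<open>?h\<close> back
    in.\<close>
  also have "\<dots> = ?h (sweedler A A (\<Delta> x) (\<lambda>a b. sweedler A A (\<Delta> b) (\<lambda>b1 b2. tens3 A A A a b1 b2)))"
    using coalgebra x by (simp add: is_coalgebra_def)
  also have "\<dots> = sweedler A A (\<Delta> x) (\<lambda>a b. ?h (sweedler A A (\<Delta> b) (\<lambda>b1 b2. tens3 A A A a b1 b2)))"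
    by (rule sweedler_comp[OF comul_carrier[OF x] h V3])
      (simp add: sweedler_closed[OF comul_carrier V3] t3)
  also have "\<dots> = sweedler A A (\<Delta> x) (\<lambda>a b. rslice \<phi> (scale A (\<psi> a) b))"
  proof (rule sweedler_cong[OF comul_carrier[OF x], symmetric])
    fix a b assume ab: "a \<in> carrier A" "b \<in> carrier A"
    have "rslice \<phi> (scale A (\<psi> a) b) = scale A (\<psi> a) (rslice \<phi> b)"
      using lin_rslice[OF \<phi>] ab by (simp add: lin_def)
    also have "\<dots> = sweedler A A (\<Delta> b) (\<lambda>b1 b2. scale A (\<psi> a) (scale A (\<phi> b2) b1))"
      unfolding rslice_def
      by (rule sweedler_comp[OF comul_carrier[OF ab(2)] lin_scale[OF space] space scale_carrier])
    also have "\<dots> = sweedler A A (\<Delta> b) (\<lambda>b1 b2. ?h (tens3 A A A a b1 b2))"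
      by (rule sweedler_cong[OF comul_carrier[OF ab(2)]]) (simp add: h3 ab)
    also have "\<dots> = ?h (sweedler A A (\<Delta> b) (\<lambda>b1 b2. tens3 A A A a b1 b2))"
      by (rule sweedler_comp[OF comul_carrier[OF ab(2)] h V3, symmetric]) (simp add: t3 ab)
    finally show "rslice \<phi> (scale A (\<psi> a) b) = \<dots>" .
  qed
  also have "\<dots> = rslice \<phi> (lslice \<psi> x)"
    unfolding lslice_def
    by (rule sweedler_comp[OF comul_carrier[OF x] lin_rslice[OF \<phi>] space scale_carrier, symmetric])
  finally show ?thesis .
qed

section \<open>The filtration by degree and elements killed by contractions\<close>

lemma G_carrier: "G n \<subseteq> carrier A"
  using G_subspace by (simp add: is_subspace_def)

text \<open>The bound is strict: \<open>filt 0\<close> is zero and \<open>filt (Suc n)\<close>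
  collects the degrees up to \<open>n\<close>. Inductions thus start from a trivial case.\<close>

definition filt :: "nat \<Rightarrow> 'a set" where
  "filt n = {(\<Sum>i<n. f i) | f. \<forall>i. f i \<in> G i}"

lemma filt_0: "filt 0 = {0}"
  using G_subspace by (auto simp: filt_def is_subspace_def intro!: exI[of _ "\<lambda>_. 0"])

lemma filt_subspace: "is_subspace A (filt n)"
  unfolding is_subspace_def
proof (intro conjI ballI allI subsetI)
  note G = G_subspace[unfolded is_subspace_def]
  show "x \<in> carrier A" if "x \<in> filt n" for x
    using that G_carrier by (auto simp: filt_def intro!: is_subspace_sum[OF carrier_subspace])
  show "0 \<in> filt n" unfolding filt_def using G by (auto intro!: exI[of _ "\<lambda>_. 0"])
  fix x assume "x \<in> filt n"
  then obtain f where f: "\<And>i. f i \<in> G i" "x = (\<Sum>i<n. f i)" by (auto simp: filt_def)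
  have "scale A c x = (\<Sum>i<n. scale A c (f i))" for c by (simp add: f(2) vs.scale_sum_right)
  then show "scale A c x \<in> filt n" for c
    using f(1) G unfolding filt_def by (auto intro!: exI[of _ "\<lambda>i. scale A c (f i)"])
  fix y assume "y \<in> filt n"
  then obtain g where g: "\<And>i. g i \<in> G i" "y = (\<Sum>i<n. g i)" by (auto simp: filt_def)
  have "x + y = (\<Sum>i<n. f i + g i)" by (simp add: f(2) g(2) sum.distrib)
  then show "x + y \<in> filt n"
    using f(1) g(1) G unfolding filt_def by (auto intro!: exI[of _ "\<lambda>i. f i + g i"])
qed

lemma filt_carrier: "filt n \<subseteq> carrier A"
  using filt_subspace by (simp add: is_subspace_def)

lemma G_subset_filt:
  assumes "i < n"
  shows "G i \<subseteq> filt n"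
proof
  fix x assume x: "x \<in> G i"
  have "(\<Sum>j<n. if j = i then x else 0) = x" using assms by simp
  moreover have "\<forall>j. (if j = i then x else 0) \<in> G j"
    using x G_subspace by (auto simp: is_subspace_def)
  ultimately show "x \<in> filt n" unfolding filt_def by (auto intro!: exI[of _ "\<lambda>j. if j = i then x else 0"])
qed

text \<open>A homogeneous element of degree m \<le> n has coproduct terms of bidegree (i, m - i), so
  testing \<open>f\<close> on bidegrees of total at most \<open>n\<close> is enough; linearity then
  covers sums of such elements.\<close>

lemma sweedler_filt:
  assumes f: "bilin A A C f" "vec_space C" "is_subspace C U" and r: "r \<in> filt (Suc n)"
    and fU: "\<And>i j a b. i + j \<le> n \<Longrightarrow> a \<in> G i \<Longrightarrow> b \<in> G j \<Longrightarrow> f a b \<in> U"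
  shows "sweedler A A (\<Delta> r) f \<in> U"
proof -
  let ?g = "\<lambda>t. sweedler A A t f"
  have g: "lin (tensor A A) C ?g" by (rule lin_sweedler[OF f(1,2) space space])
  have hom: "?g (\<Delta> x) \<in> U" if x: "x \<in> G m" and m: "m \<le> n" for x m
  proof -
    obtain u where u: "\<And>i. i \<le> m \<Longrightarrow> u i \<in> tens_sub A A (G i) (G (m - i))" "\<Delta> x = (\<Sum>i\<le>m. u i)"
      using comul_G[OF x] by blast
    have "u i \<in> carrier (tensor A A)" if "i \<le> m" for i
      using subsetD[OF tens_sub_mono[OF G_carrier G_carrier] u(1)[OF that]] by (simp add: tensor_def)
    then have "?g (\<Delta> x) = (\<Sum>i\<le>m. ?g (u i))"
      unfolding u(2) by (intro conjunct2[OF lin_sum[OF g vec_space_tensor[OF space space]]]) auto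
    also have "\<dots> \<in> U"
    proof (rule is_subspace_sum[OF f(3)])
      fix i assume "i \<in> {..m}"
      then show "?g (u i) \<in> U"
        using m by (intro sweedler_in_subspace[OF f u(1) G_carrier G_carrier] fU) auto
    qed simp
    finally show ?thesis .
  qed
  obtain h where h: "\<And>i. h i \<in> G i" "r = (\<Sum>i<Suc n. h i)" using r unfolding filt_def by blast
  have "?g (\<Delta> r) = (\<Sum>i<Suc n. ?g (\<Delta> (h i)))"
    unfolding h(2) by (rule conjunct2[OF lin_sum[OF lin_comp[OF lin_comul g] space]]) (use h(1) G_carrier in auto)
  also have "\<dots> \<in> U"
    by (rule is_subspace_sum[OF f(3)]) (auto intro: hom[OF h(1)])
  finally show ?thesis .
qed

lemma vanish_G_0:
  assumes "lin A ground \<psi>" "\<psi> e = 0" "a \<in> G 0"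
  shows "\<psi> a = 0"
  using assms e_carrier by (auto simp: G_0 lin_def ground_def)

text \<open>Terms whose first factor has degree 0 die because \<psi> vanishes on the span of
  \<open>e\<close>; in the others the first factor takes up at least one degree.\<close>

lemma lslice_filt:
  assumes "lin A ground \<psi>" "\<psi> e = 0" "r \<in> filt (Suc n)"
  shows "lslice \<psi> r \<in> filt n"
  unfolding lslice_def
proof (rule sweedler_filt[OF bilin_scale_left[OF assms(1) space] space filt_subspace assms(3)])
  fix i j a b assume *: "i + j \<le> n" "a \<in> G i" "b \<in> G j"
  show "scale A (\<psi> a) b \<in> filt n"
  proof (cases "i = 0")
    case True
    then show ?thesis using vanish_G_0[OF assms(1,2)] * filt_subspace by (simp add: is_subspace_def)
  next
    case False
    \<comment> \<open>From i \<ge> 1 and i + j \<le> n follows j < n, the strict bound in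
      \<open>filt n\<close>.\<close>
    then have "b \<in> filt n" using * G_subset_filt[of j n] by auto
    then show ?thesis using filt_subspace by (simp add: is_subspace_def)
  qed
qed

lemma rslice_filt:
  assumes "lin A ground \<phi>" "\<phi> e = 0" "r \<in> filt (Suc n)"
  shows "rslice \<phi> r \<in> filt n"
  unfolding rslice_def
proof (rule sweedler_filt[OF bilin_scale_right[OF assms(1) space] space filt_subspace assms(3)])
  fix i j a b assume *: "i + j \<le> n" "a \<in> G i" "b \<in> G j"
  show "scale A (\<phi> b) a \<in> filt n"
  proof (cases "j = 0")
    case True
    then show ?thesis using vanish_G_0[OF assms(1,2)] * filt_subspace by (simp add: is_subspace_def)
  next
    case False
    then have "a \<in> filt n" using * G_subset_filt[of i n] by auto
    then show ?thesis using filt_subspace by (simp add: is_subspace_def)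
  qed
qed

text \<open>By \<open>tensor_eq_by_slices\<close> it is enough to compare the right contractions of
  both sides with every \<phi>. Subtracting \<phi>(e) \<epsilon> reduces to functionals vanishing at
  \<open>e\<close>, and the counit axioms determine the scalar that \<open>sl\<close> leaves
  open.\<close>

lemma primitive_if_slices:
  assumes z: "z \<in> carrier A" "\<epsilon> z = 0"
    and sl: "\<And>\<phi>. lin A ground \<phi> \<Longrightarrow> \<phi> e = 0 \<Longrightarrow> rslice \<phi> z \<in> G 0"
  shows "\<Delta> z = tens A A z e + tens A A e z"
proof -
  have ts: "tens A A z e + tens A A e z = tens_sum A A [(z, e), (e, z)]" by (simp add: tens_sum_def)
  have "tens A A z e + tens A A e z \<in> carrier (tensor A A)"
    unfolding ts using z(1) e_carrier by (force simp: tensor_def tens_sub_def)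
  with space space comul_carrier[OF z(1)] show ?thesis
  proof (rule tensor_eq_by_slices)
    fix \<phi> :: "'a \<Rightarrow> 'k" assume \<phi>: "lin A ground \<phi>"
    \<comment> \<open>Since \<epsilon>(e) = 1, the corrected functional vanishes at
      \<open>e\<close>.\<close>
    define \<phi>' where "\<phi>' x = \<phi> x - \<phi> e * \<epsilon> x" for x
    have \<phi>': "lin A ground \<phi>'"
      using \<phi> lin_counit by (simp add: \<phi>'_def lin_def ground_def algebra_simps)
    obtain c where c: "rslice \<phi>' z = scale A c e"
      using sl[OF \<phi>'] counit_e by (auto simp: \<phi>'_def G_0)
    \<comment> \<open>Applying \<epsilon> identifies \<open>c\<close>: \<epsilon> and \<phi>'
      contract different factors, so they can be exchanged, and the left counit axiom leaves
      \<phi>'(z), which is \<phi>(z) because \<epsilon>(z) = 0.\<close>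
    have "\<epsilon> (rslice \<phi>' z) = sweedler A A (\<Delta> z) (\<lambda>a b. \<epsilon> (scale A (\<phi>' b) a))"
      unfolding rslice_def by (rule sweedler_comp[OF comul_carrier[OF z(1)] lin_counit space scale_carrier])
    also have "\<dots> = sweedler A A (\<Delta> z) (\<lambda>a b. \<phi>' (scale A (\<epsilon> a) b))"
      by (rule sweedler_cong[OF comul_carrier[OF z(1)]])
        (use \<phi>' lin_counit in \<open>simp add: lin_def ground_def mult.commute\<close>)
    also have "\<dots> = \<phi>' (lslice \<epsilon> z)"
      unfolding lslice_def
      by (rule sweedler_comp[OF comul_carrier[OF z(1)] \<phi>' space scale_carrier, symmetric])
    finally have "\<epsilon> (rslice \<phi>' z) = \<phi> z" by (simp add: lslice_counit z \<phi>'_def)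
    then have c\<phi>: "c = \<phi> z"
      using lin_counit e_carrier by (simp add: c lin_def ground_def counit_e)
    \<comment> \<open>Undoing the correction: the subtracted term is \<phi>(e) times the contraction
      with \<epsilon>, and that contraction is \<open>z\<close>.\<close>
    have "rslice \<phi>' z = sweedler A A (\<Delta> z)
        (\<lambda>a b. scale A (\<phi> b) a - scale A (\<phi> e) (scale A (\<epsilon> b) a))"
      by (simp add: rslice_def \<phi>'_def vs.scale_left_diff_distrib)
    also have "\<dots> = rslice \<phi> z - sweedler A A (\<Delta> z) (\<lambda>a b. scale A (\<phi> e) (scale A (\<epsilon> b) a))"
      unfolding rslice_def by (rule sweedler_diff[OF comul_carrier[OF z(1)]])
    also have "sweedler A A (\<Delta> z) (\<lambda>a b. scale A (\<phi> e) (scale A (\<epsilon> b) a)) = scale A (\<phi> e) (rslice \<epsilon> z)"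
      unfolding rslice_def
      by (rule sweedler_comp[OF comul_carrier[OF z(1)] lin_scale[OF space] space scale_carrier, symmetric])
    finally have "rslice \<phi> z = scale A (\<phi> e) z + scale A (\<phi> z) e"
      by (simp add: c c\<phi> rslice_counit z(1))
    moreover have "sweedler A A (tens_sum A A [(z, e), (e, z)]) (\<lambda>a b. scale A (\<phi> b) a) =
        scale A (\<phi> e) z + scale A (\<phi> z) e"
      by (subst sweedler_sum_tens[OF bilin_scale_right[OF \<phi> space] space]) (use z(1) e_carrier in auto)
    ultimately show "sweedler A A (\<Delta> z) (\<lambda>a b. scale A (\<phi> b) a) =
        sweedler A A (tens A A z e + tens A A e z) (\<lambda>a b. scale A (\<phi> b) a)"
      by (simp only: ts rslice_def)
  qed
qed

text \<open>In the application \<Psi> consists of the functionals \<tau>(-, w), and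
  \<open>prim\<close> combines the Nichols property with the injectivity of
  \<open>\<tau>\<^sub>1\<close>. Induction on \<open>n\<close> works because right contractions
  lower the filtration and commute with the left ones.\<close>

lemma common_kernel_lslice:
  assumes \<Psi>: "\<And>\<psi>. \<psi> \<in> \<Psi> \<Longrightarrow> lin A ground \<psi> \<and> \<psi> e = 0"
    and prim: "\<And>x. x \<in> carrier A \<Longrightarrow> \<Delta> x = tens A A x e + tens A A e x \<Longrightarrow> \<forall>\<psi>\<in>\<Psi>. \<psi> x = 0 \<Longrightarrow> x = 0"
    and "x \<in> filt n" "\<And>\<psi>. \<psi> \<in> \<Psi> \<Longrightarrow> lslice \<psi> x = 0"
  shows "x \<in> G 0"
  using assms(3,4)
proof (induction n arbitrary: x)
  case 0
  then show ?case using G_subspace by (simp add: filt_0 is_subspace_def)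
next
  case (Suc n)
  have xA: "x \<in> carrier A" using Suc.prems(1) filt_carrier by blast
  \<comment> \<open>Normalising to \<epsilon>(z) = 0 is what \<open>primitive_if_slices\<close> asks
    for. The subtracted multiple of \<open>e\<close> lies in \<open>filt (Suc n)\<close>, and all
    \<psi> in \<Psi> contract it to zero.\<close>
  define z where "z = x - scale A (\<epsilon> x) e"
  have G0e: "scale A c e \<in> G 0" for c by (auto simp: G_0)
  have zF: "z \<in> filt (Suc n)"
    unfolding z_def using Suc.prems(1) G0e G_subset_filt[of 0 "Suc n"]
    by (intro is_subspace_diff[OF space filt_subspace]) auto
  then have zA: "z \<in> carrier A" using filt_carrier by blast
  have "\<epsilon> z = \<epsilon> x - \<epsilon> (scale A (\<epsilon> x) e)"
    unfolding z_def by (rule lin_diff[OF lin_counit space xA scale_carrier[OF e_carrier]])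
  then have \<epsilon>z: "\<epsilon> z = 0"
    using lin_counit e_carrier by (simp add: lin_def ground_def counit_e)
  have zK: "lslice \<psi> z = 0" if "\<psi> \<in> \<Psi>" for \<psi>
  proof -
    note L = lin_lslice[OF conjunct1[OF \<Psi>[OF that]]]
    have "lslice \<psi> z = lslice \<psi> x - lslice \<psi> (scale A (\<epsilon> x) e)"
      unfolding z_def by (rule lin_diff[OF L space xA scale_carrier[OF e_carrier]])
    also have "lslice \<psi> (scale A (\<epsilon> x) e) = scale A (\<epsilon> x) (lslice \<psi> e)"
      using L e_carrier by (simp add: lin_def)
    finally show ?thesis using Suc.prems(2)[OF that] \<Psi>[OF that] by (simp add: lslice_e)
  qed
  have dz: "\<Delta> z = tens A A z e + tens A A e z"
  proof (rule primitive_if_slices[OF zA \<epsilon>z])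
    fix \<phi> assume \<phi>: "lin A ground \<phi>" "\<phi> e = 0"
    show "rslice \<phi> z \<in> G 0"
    proof (rule Suc.IH[OF rslice_filt[OF \<phi> zF]])
      fix \<psi> assume "\<psi> \<in> \<Psi>"
      then show "lslice \<psi> (rslice \<phi> z) = 0"
        using \<Psi> zK lslice_rslice[OF _ \<phi>(1) zA] lin_zero[OF lin_rslice[OF \<phi>(1)] space] by simp
    qed
  qed
  have "e \<noteq> 0" using lin_zero[OF lin_counit space] counit_e by auto
  have "z = 0"
  proof (rule prim[OF zA dz], rule ballI)
    fix \<psi> assume "\<psi> \<in> \<Psi>"
    \<comment> \<open>On a primitive element the contraction is \<psi>(z) e + \<psi>(e) z. It
      vanishes, and so does \<psi>(e), leaving \<psi>(z) e = 0.\<close>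
    then have "\<psi> e = 0" "scale A (\<psi> z) e + scale A (\<psi> e) z = 0"
      using \<Psi> zK lslice_primitive[OF _ zA dz, of \<psi>] by auto
    then show "\<psi> z = 0" using \<open>e \<noteq> 0\<close> by simp
  qed
  then show ?case using G0e[of "\<epsilon> x"] by (simp add: z_def)
qed

text \<open>A nonzero element of least filtration index in \<open>N\<close> is killed by all of
  \<Psi>, because a nonzero contraction would lie in \<open>N\<close> with a smaller index. Such an
  element is a nonzero multiple of \<open>e\<close>.\<close>

lemma e_mem_stable_subspace:
  assumes \<Psi>: "\<And>\<psi>. \<psi> \<in> \<Psi> \<Longrightarrow> lin A ground \<psi> \<and> \<psi> e = 0"
    and prim: "\<And>x. x \<in> carrier A \<Longrightarrow> \<Delta> x = tens A A x e + tens A A e x \<Longrightarrow> \<forall>\<psi>\<in>\<Psi>. \<psi> x = 0 \<Longrightarrow> x = 0"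
    and N: "is_subspace A N" "\<And>\<psi> x. \<psi> \<in> \<Psi> \<Longrightarrow> x \<in> N \<Longrightarrow> lslice \<psi> x \<in> N" "N \<noteq> {0}"
  shows "e \<in> N"
proof -
  have "0 \<in> N" using N(1) by (simp add: is_subspace_def)
  then obtain y where y: "y \<in> N" "y \<noteq> 0" using N(3) by blast
  then have "y \<in> carrier A" using N(1) by (auto simp: is_subspace_def)
  then have "\<exists>n. y \<in> filt n" using G_exhaust unfolding filt_def by blast
  then have ex: "\<exists>n. \<exists>x\<in>N. x \<noteq> 0 \<and> x \<in> filt n" using y by blast
  define n where "n = (LEAST n. \<exists>x\<in>N. x \<noteq> 0 \<and> x \<in> filt n)"
  obtain x where x: "x \<in> N" "x \<noteq> 0" "x \<in> filt n"
    using LeastI_ex[OF ex] unfolding n_def by blast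
  \<comment> \<open>The index is positive since \<open>filt 0\<close> contains only 0; contractions
    of \<open>x\<close> land in the preceding step.\<close>
  then obtain m where m: "n = Suc m" using filt_0 by (cases n) auto
  have "lslice \<psi> x = 0" if "\<psi> \<in> \<Psi>" for \<psi>
  proof (rule ccontr)
    assume "lslice \<psi> x \<noteq> 0"
    then have "\<exists>x\<in>N. x \<noteq> 0 \<and> x \<in> filt m"
      using lslice_filt[of \<psi> x m] \<Psi>[OF that] N(2)[OF that x(1)] x(3) m by blast
    then have "n \<le> m" unfolding n_def by (rule Least_le)
    then show False using m by simp
  qed
  then have "x \<in> G 0" using common_kernel_lslice[OF \<Psi> prim x(3)] by blast
  then obtain c where c: "x = scale A c e" by (auto simp: G_0)
  then have "c \<noteq> 0" using x(2) by auto
  then have "e = scale A (inverse c) x" by (simp add: c)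
  then show ?thesis using N(1) x(1) by (simp add: is_subspace_def)
qed

end

section \<open>Pre-Nichols algebras and simplicity over the q-boson algebra\<close>

lemma connected_coalgebra_pre_nichols:
  assumes "pre_nichols J V R \<iota>"
  shows "connected_coalgebra R (comul R) (counit R) (unit R) (grade R)"
proof
  have P: "graded_braided_bialgebra J R" "grade R 0 = {scale R c (unit R) | c. True}"
    using assms unfolding pre_nichols_def by blast+
  have B: "braided_bialgebra J R" "graded_space R (grade R)"
    and comul: "\<forall>n. \<forall>r\<in>grade R n. \<exists>u. (\<forall>i\<le>n. u i \<in> tens_sub R R (grade R i) (grade R (n - i)))
      \<and> comul R r = (\<Sum>i\<le>n. u i)"
    using P(1) unfolding graded_braided_bialgebra_def by blast+
  \<comment> \<open>As a coalgebra a braided bialgebra is an ordinary one: the braiding appears in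
    the compatibility of product and coproduct.\<close>
  show "is_coalgebra R (comul R) (counit R)" "counit R (unit R) = 1"
    "comul R (unit R) = tens R R (unit R) (unit R)"
    using B(1) unfolding braided_bialgebra_def by blast+
  show "grade R 0 = {scale R c (unit R) | c. True}" by (rule P(2))
  show "unit R \<in> carrier R"
    using B(1) unfolding braided_bialgebra_def is_algebra_def by blast
  show "is_subspace R (grade R n)" for n
    using B(2) unfolding graded_space_def by blast
  show "\<exists>u. (\<forall>i\<le>n. u i \<in> tens_sub R R (grade R i) (grade R (n - i))) \<and> comul R r = (\<Sum>i\<le>n. u i)"
    if "r \<in> grade R n" for r n using comul that by blast
  fix r assume "r \<in> carrier R"
  then obtain f where f: "\<And>n. f n \<in> grade R n" "finite {n. f n \<noteq> 0}" "r = (\<Sum>n | f n \<noteq> 0. f n)"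
    using B(2) unfolding graded_space_def by meson
  \<comment> \<open>The grading supplies a finitely supported family; a bound on its support turns
    the sum into one over an initial segment, as in the definition of \<open>filt\<close>.\<close>
  obtain n where "{n. f n \<noteq> 0} \<subseteq> {..<n}" using f(2) unfolding finite_nat_set_iff_bounded by blast
  then have "r = (\<Sum>i<n. f i)" unfolding f(3) by (intro sum.mono_neutral_left) auto
  then show "\<exists>f n. (\<forall>i. f i \<in> grade R i) \<and> r = (\<Sum>i<n. f i)" using f(1) by blast
qed

theorem theorem3p6:
  fixes J :: "('k::field, 'j::ab_group_add) hopf"
    and K :: "('k, 'l::ab_group_add) hopf"
    and \<tau>\<^sub>0 :: "'j \<Rightarrow> 'l \<Rightarrow> 'k"
    and V :: "('k, 'v::ab_group_add, 'j) yd"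
    and W :: "('k, 'w::ab_group_add, 'l) yd"
    and \<tau>\<^sub>1 :: "'v \<Rightarrow> 'w \<Rightarrow> 'k"
    and R :: "('k, 'r::ab_group_add, 'j) graded_yd" and \<iota> :: "'v \<Rightarrow> 'r"
    and S :: "('k, 's::ab_group_add, 'l) graded_yd" and \<kappa> :: "'w \<Rightarrow> 's"
    and \<tau> :: "('k, 'r, 'j) tens \<Rightarrow> ('k, 's, 'l) tens \<Rightarrow> 'k"
    and m :: "('k, 'r, 's) tens \<Rightarrow> ('k, 'r, 's) tens \<Rightarrow> ('k, 'r, 's) tens"
    and ac :: "('k, 'r, 's) tens \<Rightarrow> 'r \<Rightarrow> 'r"
  assumes "hopf_algebra J" "bij_antipode J" "hopf_algebra K" "bij_antipode K"
    and "skew_pairing J K \<tau>\<^sub>0"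
    and "yd_module J V" "yd_module K W"
    and "compatible_form J K \<tau>\<^sub>0 V W \<tau>\<^sub>1"
    and "pre_nichols J V R \<iota>" "pre_nichols K W S \<kappa>"
    and "extended_pairing J K \<tau>\<^sub>0 V W \<tau>\<^sub>1 R \<iota> S \<kappa> \<tau>"
    and "q_boson_algebra J K \<tau>\<^sub>0 V W \<tau>\<^sub>1 R \<iota> S \<kappa> m"
    and "q_boson_action J K R S \<tau> m ac"
    and "inj_on (\<lambda>v. restrict (\<tau>\<^sub>1 v) (carrier W)) (carrier V)"
    and "nichols J V R \<iota>"
  shows "simple_left_module (tensor R S) m (tens R S (unit R) (unit S)) R ac"
proof -
  interpret R: connected_coalgebra R "comul R" "counit R" "unit R" "grade R"
    by (rule connected_coalgebra_pre_nichols[OF assms(9)])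
  \<comment> \<open>Pairing with \<open>w\<close>, restricted to \<open>R\<close> inside its
    bosonization; the left contraction with it is the action of \<open>w\<close>.\<close>
  define \<psi> where "\<psi> w = (\<lambda>r. \<tau> (tens R J r (hone J)) (tens S K (\<kappa> w) (hone K)))" for w
  have vs: "vec_space J" "vec_space K" "hone J \<in> carrier J" "hone K \<in> carrier K"
    using assms(1,3) by (auto simp: hopf_algebra_def is_bialgebra_def is_algebra_def)
  interpret S: connected_coalgebra S "comul S" "counit S" "unit S" "grade S"
    by (rule connected_coalgebra_pre_nichols[OF assms(10)])
  note S = S.space S.e_carrier
  have R_alg: "is_algebra R (mul R) (unit R)"
    using assms(9) unfolding pre_nichols_def graded_braided_bialgebra_def braided_bialgebra_def by blast
  have "lin W S \<kappa>"
    using assms(10) unfolding pre_nichols_def yd_hom_def by (elim conjE)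
  then have \<kappa>: "\<kappa> w \<in> carrier S" if "w \<in> carrier W" for w
    using that by (simp add: lin_def)
  have \<iota>: "bij_betw \<iota> (carrier V) (grade R 1)"
    using assms(9) unfolding pre_nichols_def by (elim conjE)
  have lin_\<iota>: "lin V R \<iota>"
    using assms(9) unfolding pre_nichols_def yd_hom_def by (elim conjE)
  have V: "vec_space V" using assms(6) by (simp add: yd_module_def left_module_def)
  have E: "skew_pairing (bosonization R J) (bosonization S K) \<tau>"
    "\<forall>v\<in>carrier V. \<forall>w\<in>carrier W. \<tau> (tens R J (\<iota> v) (hone J)) (tens S K (\<kappa> w) (hone K)) = \<tau>\<^sub>1 v w"
    "\<forall>a\<in>carrier J. \<forall>w\<in>carrier W. \<tau> (tens R J (unit R) a) (tens S K (\<kappa> w) (hone K)) = 0"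
    using assms(11) unfolding extended_pairing_def by blast+
  have \<tau>: "bilin (bosonization R J) (bosonization S K) ground \<tau>"
    using E(1) unfolding skew_pairing_def by blast
  have boson: "carrier (bosonization R J) = carrier (tensor R J)"
    "scale (bosonization R J) = scale (tensor R J)"
    "carrier (bosonization S K) = carrier (tensor S K)"
    by (simp_all add: bosonization_def Let_def)
  have tS: "tens S K s (hone K) \<in> carrier (tensor S K)" if "s \<in> carrier S" for s
    using bilin_tens[OF S(1) vs(2)] that vs(4) by (simp add: bilin_def lin_def)
  have tRS: "tens R S (unit R) s \<in> carrier (tensor R S)" if "s \<in> carrier S" for s
    using bilin_tens[OF R.space S(1)] that R.e_carrier by (simp add: bilin_def lin_def)
  have tRS': "tens R S r (unit S) \<in> carrier (tensor R S)" if "r \<in> carrier R" for r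
    using bilin_tens[OF R.space S(1)] that S(2) by (simp add: bilin_def lin_def)
  have \<psi>_lin: "lin R ground (\<psi> w)" if "w \<in> carrier W" for w
  proof -
    have "lin R (tensor R J) (\<lambda>r. tens R J r (hone J))"
      using bilin_tens[OF R.space vs(1)] vs(3) by (simp add: bilin_def)
    moreover have "lin (tensor R J) ground (\<lambda>t. \<tau> t (tens S K (\<kappa> w) (hone K)))"
      using \<tau> tS[OF \<kappa>[OF that]] unfolding bilin_def lin_def boson by blast
    ultimately show ?thesis unfolding \<psi>_def by (rule lin_comp)
  qed
  have \<psi>_unit: "\<psi> w (unit R) = 0" if "w \<in> carrier W" for w
    using E(3) vs(3) that by (simp add: \<psi>_def)
  have prim: "x = 0"
    if x: "x \<in> carrier R" "comul R x = tens R R x (unit R) + tens R R (unit R) x"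
      and zero: "\<forall>\<chi>\<in>\<psi> ` carrier W. \<chi> x = 0" for x
  proof -
    \<comment> \<open>The Nichols property enters here: primitives have degree one and so come from
      \<open>V\<close>.\<close>
    have "x \<in> grade R 1" using assms(15) x by (auto simp: nichols_def primitives_def)
    then obtain v where v: "v \<in> carrier V" "x = \<iota> v" using \<iota> by (auto simp: bij_betw_def)
    have 0: "0 \<in> carrier V" using V by (simp add: vec_space_def is_subspace_def)
    \<comment> \<open>Injectivity is stated as \<open>inj_on\<close>, so \<open>v\<close> is
      compared with the vector 0; both forms vanish on \<open>W\<close>.\<close>
    have "\<tau>\<^sub>1 v w = \<tau>\<^sub>1 0 w" if w: "w \<in> carrier W" for w
    proof -
      have "\<tau>\<^sub>1 v w = \<psi> w x" using E(2) v w by (simp add: \<psi>_def)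
      also have "\<dots> = 0" using zero w by simp
      also have "0 = \<tau>\<^sub>1 0 w"
        using lin_zero[OF _ V, of ground "\<lambda>v. \<tau>\<^sub>1 v w"] assms(8) w
        by (simp add: compatible_form_def bilin_def)
      finally show ?thesis .
    qed
    then have "v = 0"
      by (intro inj_onD[OF assms(14) _ v(1) 0]) (auto simp: restrict_def)
    then show ?thesis using v(2) lin_zero[OF lin_\<iota> V] by simp
  qed
  have Q: "left_module (tensor R S) m (tens R S (unit R) (unit S)) R ac"
    "\<forall>r\<in>carrier R. \<forall>r'\<in>carrier R. ac (tens R S r (unit S)) r' = mul R r r'"
    "\<forall>s\<in>carrier S. \<forall>r\<in>carrier R. ac (tens R S (unit R) s) r =
      sweedler R R (comul R r) (\<lambda>r\<^sub>1 r\<^sub>2. scale R (\<tau> (tens R J r\<^sub>1 (hone J)) (tens S K s (hone K))) r\<^sub>2)"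
    using assms(13) unfolding q_boson_action_def by blast+
  have slice: "ac (tens R S (unit R) (\<kappa> w)) r = R.lslice (\<psi> w) r"
    if "w \<in> carrier W" "r \<in> carrier R" for w r
    using Q(3) \<kappa>[OF that(1)] that(2) by (simp add: R.lslice_def \<psi>_def)
  have "N = {0} \<or> N = carrier R"
    if N: "is_subspace R N" "\<forall>a\<in>carrier (tensor R S). \<forall>v\<in>N. ac a v \<in> N" for N
  proof (intro disjCI)
    have sub: "N \<subseteq> carrier R" using N(1) by (simp add: is_subspace_def)
    assume "N \<noteq> carrier R"
    show "N = {0}"
    proof (rule ccontr)
      assume "N \<noteq> {0}"
      have "unit R \<in> N"
      \<comment> \<open>Stability under the elements 1 \<otimes> w brings the unit into
        \<open>N\<close>; the elements r \<otimes> 1 are used afterwards.\<close>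
      proof (rule R.e_mem_stable_subspace[of "\<psi> ` carrier W", OF _ prim N(1) _ \<open>N \<noteq> {0}\<close>])
        fix \<chi> x assume \<chi>: "\<chi> \<in> \<psi> ` carrier W" and x: "x \<in> N"
        obtain w where w: "w \<in> carrier W" "\<chi> = \<psi> w" using \<chi> by blast
        have "R.lslice \<chi> x = ac (tens R S (unit R) (\<kappa> w)) x"
          using slice[OF w(1)] x sub w(2) by auto
        then show "R.lslice \<chi> x \<in> N" using N(2) x tRS[OF \<kappa>[OF w(1)]] by simp
      qed (use \<psi>_lin \<psi>_unit in auto)
      have "r \<in> N" if "r \<in> carrier R" for r
      proof -
        \<comment> \<open>Left multiplication by \<open>R\<close> generates everything from the
          unit, so \<open>N\<close> contains each r = r 1.\<close>
        have "ac (tens R S r (unit S)) (unit R) \<in> N"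
          using N(2) tRS'[OF that] \<open>unit R \<in> N\<close> by blast
        also have "ac (tens R S r (unit S)) (unit R) = mul R r (unit R)"
          using Q(2) that R.e_carrier by blast
        also have "\<dots> = r" using R_alg that by (simp add: is_algebra_def)
        finally show ?thesis .
      qed
      then show False using sub \<open>N \<noteq> carrier R\<close> by blast
    qed
  qed
  moreover have "carrier R \<noteq> {0}"
    using R.e_carrier R.counit_e lin_zero[OF R.lin_counit R.space] by auto
  ultimately show ?thesis using Q(1) unfolding simple_left_module_def by blast
qed

end
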